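(* Let $\mathcal{A}$ be a reflective subcategory of $\mathcal{C}$ with reflector $F$ and reflection morphisms $\eta_X:X\to FX$, and let $\mathcal{S}$ be a co-perfect syntopogenous structure on $\mathcal{A}$ with respect to $\mathcal{M}$. For $X\in\mathcal{C}$ put $$\mathcal{B}^{\mathcal{A}}_X=\{U^{\sqsubset^{\mathcal{A}}}\;|\;U^{\sqsubset}\in\mathcal{B}^{\mathcal{S}}_{FX}\},\qquad U^{\sqsubset^{\mathcal{A}}}(m)=\eta_X^{-1}\big(U^{\sqsubset}(\eta_X(m))\big)\quad(m\in\mathrm{sub}X).$$ Then $\mathcal{B}^{\mathcal{A}}$ is a base for the coarsest quasi-uniformity $\mathcal{U}^{\mathcal{S}^{\mathcal{A}}}$ on $\mathcal{C}$ with respect to $\mathcal{M}$ for which every reflection morphism $\eta_X:X\to FX$ is $(\mathcal{U}^{\mathcal{S}^{\mathcal{A}}},\mathcal{U}^{\mathcal{S}})$-continuous. Moreover, $\mathcal{B}^{\mathcal{A}}$ is a transitive base provided that $\mathcal{S}^{\mathcal{A}}$ is interpolative.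
   Context: $\mathcal{C}$ is a category with a proper $(\mathcal{E},\mathcal{M})$-factorization system for morphisms ($\mathcal{E}$ consists of epimorphisms, $\mathcal{M}$ of monomorphisms), and it is $\mathcal{M}$-complete: pullbacks of $\mathcal{M}$-morphisms along arbitrary morphisms and arbitrary $\mathcal{M}$-intersections exist and are again in $\mathcal{M}$. The class $\mathcal{E}$ is stable under pullbacks along $\mathcal{M}$-morphisms. For $X\in\mathcal{C}$, $\mathrm{sub}X=\{m\in\mathcal{M}\mid \mathrm{cod}(m)=X\}$, ordered by $n\le m$ iff $m\circ j=n$ for some $j$; isomorphic subobjects are identified, so $\mathrm{sub}X$ is a (possibly large) complete lattice. For $f:X\to Y$, $f(m)$ is the $\mathcal{M}$-component of the factorization of $f\circ m$ and $f^{-1}(n)$ is the pullback of $n$ along $f$. The reflector is viewed as an endofunctor of $\mathcal{C}$ pointed by $\eta:1_{\mathcal{C}}\to F$. The notions below are used both on $\mathcal{C}$ and on $\mathcal{A}$; "on $\mathcal{A}$ with respect to $\mathcal{M}$" means that they are indexed by the objects $X$ of $\mathcal{A}$, with $\mathrm{sub}X$, images and inverse images as in $\mathcal{C}$ and with the axioms mentioning morphisms required for $\mathcal{A}$-morphisms. A topogenous order is a family of relations $\sqsubset_X$ on $\mathrm{sub}X$ with (T1) $m\sqsubset_X n\Rightarrow m\le n$; (T2) $m\le n\sqsubset_X p\le q\Rightarrow m\sqsubset_X q$; (T3) for every morphism $f:X\to Y$, $m\sqsubset_Y n\Rightarrow f^{-1}(m)\sqsubset_X f^{-1}(n)$. A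 relation is $\bigwedge$-preserving if ($m\sqsubset_X n_i$ for all $i\in I$) implies $m\sqsubset_X\bigwedge n_i$, and interpolates if $m\sqsubset_X n$ implies $m\sqsubset_X p\sqsubset_X n$ for some $p$. A syntopogenous structure is a family $\mathcal{S}=\{\mathcal{S}_X\}$ of sets of relations on $\mathrm{sub}X$ such that (S1) each $\sqsubset_X\in\mathcal{S}_X$ satisfies (T1), (T2); (S2) $\mathcal{S}_X$ is directed under inclusion; (S3) the relations $\bigcup\mathcal{S}_X$ form an interpolative topogenous order. It is co-perfect (interpolative) if every $\sqsubset_X\in\mathcal{S}_X$ is $\bigwedge$-preserving (interpolates). A quasi-uniformity is a family $\mathcal{U}=\{\mathcal{U}_X\}$, each $\mathcal{U}_X$ a collection of order-preserving maps $\mathrm{sub}X\to\mathrm{sub}X$ (ordered pointwise), such that (U1) $m\le U(m)$ for all $m$ and $U\in\mathcal{U}_X$; (U2) for $U\in\mathcal{U}_X$ there is $U'\in\mathcal{U}_X$ with $U'\circ U'\le U$; (U3) $U\in\mathcal{U}_X$, $U\le U'$ imply $U'\in\mathcal{U}_X$; (U4) $U,U'\in\mathcal{U}_X$ imply $U\wedge U'\in\mathcal{U}_X$; (U5) for $f:X\to Y$ and $U\in\mathcal{U}_Y$ there is $U'\in\mathcal{U}_X$ with $f(U'(m))\le U(f(m))$ for all $m\in\mathrm{sub}X$. A base is a family $\mathcal{B}=\{\mathcal{B}_X\}$ satisfying all of these except (U3); the quasi-uniformity it generates consists of all $V$ lying above some member of the base. A base is transitive if $U\circ U=U$ for all its members.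 Order: $\mathcal{U}\le\mathcal{V}$ iff for all $X$ and $U\in\mathcal{U}_X$ there is $V\in\mathcal{V}_X$ with $V\le U$; "coarsest" means least. The morphism $\eta_X:X\to FX$ is $(\mathcal{V},\mathcal{U})$-continuous ($\mathcal{V}$ on $\mathcal{C}$, $\mathcal{U}$ on $\mathcal{A}$) if for any $U\in\mathcal{U}_{FX}$ there is $V\in\mathcal{V}_X$ with $\eta_X(V(m))\le U(\eta_X(m))$ for all $m\in\mathrm{sub}X$. For co-perfect $\mathcal{S}$: $\mathcal{B}^{\mathcal{S}}_X=\{U^{\sqsubset}\mid\sqsubset_X\in\mathcal{S}_X\}$ with $U^{\sqsubset}(m)=\bigwedge\{n\mid m\sqsubset_X n\}$. Co-perfect syntopogenous structures are understood to be those corresponding to quasi-uniformities: $\mathcal{B}^{\mathcal{S}}$ is a base for a quasi-uniformity (here on $\mathcal{A}$), denoted $\mathcal{U}^{\mathcal{S}}$. $\mathcal{S}^{\mathcal{A}}$ is given by $\mathcal{S}^{\mathcal{A}}_X=\{\sqsubset^{\mathcal{A}}_X\mid\sqsubset_{FX}\in\mathcal{S}_{FX}\}$, where $m\sqsubset^{\mathcal{A}}_X n$ iff $\eta_X(m)\sqsubset_{FX}p$ and $\eta_X^{-1}(p)\le n$ for some $p\in\mathrm{sub}FX$; $\mathcal{U}^{\mathcal{S}^{\mathcal{A}}}$ denotes the quasi-uniformity generated by $\mathcal{B}^{\mathcal{A}}$. *)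

theory Defs
  imports "HOL-Algebra.Complete_Lattice"
begin

section \<open>Categories\<close>

record ('o, 'a) category =
  Ob :: "'o set"
  Ar :: "'a set"
  Dom :: "'a \<Rightarrow> 'o"
  Cod :: "'a \<Rightarrow> 'o"
  Id :: "'o \<Rightarrow> 'a"
  Comp :: "'a \<Rightarrow> 'a \<Rightarrow> 'a"  (infixr \<open>\<cdot>\<index>\<close> 70)

definition Hom :: "('o, 'a, 'z) category_scheme \<Rightarrow> 'o \<Rightarrow> 'o \<Rightarrow> 'a set" where
  "Hom C X Y = {f \<in> Ar C. Dom C f = X \<and> Cod C f = Y}"

locale category =
  fixes C :: "('o, 'a, 'z) category_scheme" (structure)
  assumes Dom_Ob: "f \<in> Ar C \<Longrightarrow> Dom C f \<in> Ob C"
    and Cod_Ob: "f \<in> Ar C \<Longrightarrow> Cod C f \<in> Ob C"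
    and Id_Hom: "X \<in> Ob C \<Longrightarrow> Id C X \<in> Hom C X X"
    and Comp_Hom: "\<lbrakk>f \<in> Hom C X Y; g \<in> Hom C Y Z\<rbrakk> \<Longrightarrow> g \<cdot> f \<in> Hom C X Z"
    and Id_left: "f \<in> Hom C X Y \<Longrightarrow> Id C Y \<cdot> f = f"
    and Id_right: "f \<in> Hom C X Y \<Longrightarrow> f \<cdot> Id C X = f"
    and Comp_assoc: "\<lbrakk>f \<in> Hom C W X; g \<in> Hom C X Y; h \<in> Hom C Y Z\<rbrakk>
      \<Longrightarrow> (h \<cdot> g) \<cdot> f = h \<cdot> (g \<cdot> f)"

definition mono_in :: "('o, 'a, 'z) category_scheme \<Rightarrow> 'a \<Rightarrow> bool" where
  "mono_in C m \<longleftrightarrow> m \<in> Ar C \<and>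
    (\<forall>W. \<forall>f\<in>Hom C W (Dom C m). \<forall>g\<in>Hom C W (Dom C m). m \<cdot>\<^bsub>C\<^esub> f = m \<cdot>\<^bsub>C\<^esub> g \<longrightarrow> f = g)"

definition epi_in :: "('o, 'a, 'z) category_scheme \<Rightarrow> 'a \<Rightarrow> bool" where
  "epi_in C e \<longleftrightarrow> e \<in> Ar C \<and>
    (\<forall>W. \<forall>f\<in>Hom C (Cod C e) W. \<forall>g\<in>Hom C (Cod C e) W. f \<cdot>\<^bsub>C\<^esub> e = g \<cdot>\<^bsub>C\<^esub> e \<longrightarrow> f = g)"

definition iso_in :: "('o, 'a, 'z) category_scheme \<Rightarrow> 'a \<Rightarrow> bool" where
  "iso_in C h \<longleftrightarrow> h \<in> Ar C \<and>
    (\<exists>k\<in>Hom C (Cod C h) (Dom C h). k \<cdot>\<^bsub>C\<^esub> h = Id C (Dom C h) \<and> h \<cdot>\<^bsub>C\<^esub> k = Id C (Cod C h))"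

text \<open>
  \<open>is_pullback C f n f' n'\<close>: the square \<open>f \<cdot> n' = n \<cdot> f'\<close> is a pullback; \<open>n'\<close> is the pullback
  of \<open>n\<close> along \<open>f\<close>, and \<open>f'\<close> the pullback of \<open>f\<close> along \<open>n\<close>.
\<close>

definition is_pullback :: "('o, 'a, 'z) category_scheme \<Rightarrow> 'a \<Rightarrow> 'a \<Rightarrow> 'a \<Rightarrow> 'a \<Rightarrow> bool" where
  "is_pullback C f n f' n' \<longleftrightarrow>
    f \<in> Ar C \<and> n \<in> Ar C \<and> Cod C f = Cod C n \<and>
    f' \<in> Hom C (Dom C n') (Dom C n) \<and> n' \<in> Hom C (Dom C n') (Dom C f) \<and>
    f \<cdot>\<^bsub>C\<^esub> n' = n \<cdot>\<^bsub>C\<^esub> f' \<and>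
    (\<forall>W. \<forall>h\<in>Hom C W (Dom C f). \<forall>k\<in>Hom C W (Dom C n). f \<cdot>\<^bsub>C\<^esub> h = n \<cdot>\<^bsub>C\<^esub> k \<longrightarrow>
      (\<exists>!u. u \<in> Hom C W (Dom C n') \<and> n' \<cdot>\<^bsub>C\<^esub> u = h \<and> f' \<cdot>\<^bsub>C\<^esub> u = k))"

definition factors_through :: "('o, 'a, 'z) category_scheme \<Rightarrow> 'a \<Rightarrow> 'a \<Rightarrow> bool" where
  "factors_through C n m \<longleftrightarrow> (\<exists>j\<in>Hom C (Dom C n) (Dom C m). m \<cdot>\<^bsub>C\<^esub> j = n)"

text \<open>
  \<open>p\<close> is the intersection (wide pullback) of the set \<open>N\<close> of monomorphisms with codomain \<open>X\<close>;
  for \<open>N = {}\<close> this says that \<open>p\<close> is terminal over \<open>X\<close>, i.e. an isomorphism.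
\<close>

definition is_intersection :: "('o, 'a, 'z) category_scheme \<Rightarrow> 'o \<Rightarrow> 'a set \<Rightarrow> 'a \<Rightarrow> bool" where
  "is_intersection C X N p \<longleftrightarrow>
    p \<in> Hom C (Dom C p) X \<and> (\<forall>n\<in>N. factors_through C p n) \<and>
    (\<forall>W. \<forall>q\<in>Hom C W X. (\<forall>n\<in>N. factors_through C q n) \<longrightarrow>
      (\<exists>!u. u \<in> Hom C W (Dom C p) \<and> p \<cdot>\<^bsub>C\<^esub> u = q))"


section \<open>Factorization systems\<close>

locale proper_factorization_system = category C
  for C :: "('o, 'a, 'z) category_scheme" (structure) +
  fixes E M :: "'a set"
  assumes E_epi: "e \<in> E \<Longrightarrow> epi_in C e"
    and M_mono: "m \<in> M \<Longrightarrow> mono_in C m"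
    and E_iso: "\<lbrakk>e \<in> E; iso_in C h; Dom C h = Cod C e\<rbrakk> \<Longrightarrow> h \<cdot> e \<in> E"
    and M_iso: "\<lbrakk>m \<in> M; iso_in C h; Cod C h = Dom C m\<rbrakk> \<Longrightarrow> m \<cdot> h \<in> M"
    and factorization: "f \<in> Ar C \<Longrightarrow> \<exists>e\<in>E. \<exists>m\<in>M. Cod C e = Dom C m \<and> m \<cdot> e = f"
    and diagonal: "\<lbrakk>e \<in> E; m \<in> M; f \<in> Hom C (Dom C e) (Dom C m); g \<in> Hom C (Cod C e) (Cod C m);
        m \<cdot> f = g \<cdot> e\<rbrakk>
      \<Longrightarrow> \<exists>!d. d \<in> Hom C (Cod C e) (Dom C m) \<and> d \<cdot> e = f \<and> m \<cdot> d = g"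

locale M_complete_category = proper_factorization_system C E M
  for C :: "('o, 'a, 'z) category_scheme" (structure) and E M :: "'a set" +
  assumes M_pullback_ex: "\<lbrakk>m \<in> M; f \<in> Ar C; Cod C f = Cod C m\<rbrakk> \<Longrightarrow> \<exists>f' m'. is_pullback C f m f' m'"
    and M_pullback_M: "\<lbrakk>m \<in> M; is_pullback C f m f' m'\<rbrakk> \<Longrightarrow> m' \<in> M"
    and M_intersection_ex: "\<lbrakk>X \<in> Ob C; N \<subseteq> {m \<in> M. Cod C m = X}\<rbrakk> \<Longrightarrow> \<exists>p. is_intersection C X N p"
    and M_intersection_M:
      "\<lbrakk>X \<in> Ob C; N \<subseteq> {m \<in> M. Cod C m = X}; is_intersection C X N p\<rbrakk> \<Longrightarrow> p \<in> M"
    and E_stable: "\<lbrakk>e \<in> E; m \<in> M; is_pullback C e m e' m'\<rbrakk> \<Longrightarrow> e' \<in> E"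


section \<open>Subobjects, images and inverse images\<close>

text \<open>
  A subobject of \<open>X\<close> is an isomorphism class of \<open>M\<close>-morphisms with codomain \<open>X\<close>.
\<close>

definition sub_iso :: "('o, 'a, 'z) category_scheme \<Rightarrow> 'a set \<Rightarrow> 'o \<Rightarrow> 'a rel" where
  "sub_iso C M X = {(m, n). m \<in> M \<and> n \<in> M \<and> Cod C m = X \<and> Cod C n = X \<and>
    (\<exists>h\<in>Hom C (Dom C n) (Dom C m). iso_in C h \<and> m \<cdot>\<^bsub>C\<^esub> h = n)}"

definition Sub :: "('o, 'a, 'z) category_scheme \<Rightarrow> 'a set \<Rightarrow> 'o \<Rightarrow> 'a set gorder" where
  "Sub C M X =
    \<lparr>carrier = {m \<in> M. Cod C m = X} // sub_iso C M X,
     eq = (=),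
     le = (\<lambda>s t. \<exists>n\<in>s. \<exists>m\<in>t. factors_through C n m)\<rparr>"

text \<open>
  The two sets below are full isomorphism classes, because factorizations and pullbacks are unique
  exactly up to isomorphism.
\<close>

definition image_sub ::
  "('o, 'a, 'z) category_scheme \<Rightarrow> 'a set \<Rightarrow> 'a set \<Rightarrow> 'a \<Rightarrow> 'a set \<Rightarrow> 'a set" where
  "image_sub C E M f s =
    {n \<in> M. \<exists>m\<in>s. \<exists>e\<in>E. Cod C e = Dom C n \<and> n \<cdot>\<^bsub>C\<^esub> e = f \<cdot>\<^bsub>C\<^esub> m}"

definition preimage_sub ::
  "('o, 'a, 'z) category_scheme \<Rightarrow> 'a \<Rightarrow> 'a set \<Rightarrow> 'a set" where
  "preimage_sub C f t = {n'. \<exists>n\<in>t. \<exists>f'. is_pullback C f n f' n'}"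


section \<open>Relations and maps on an ordered set\<close>

definition topogenous_rel :: "('b, 'z) gorder_scheme \<Rightarrow> 'b rel \<Rightarrow> bool" where
  "topogenous_rel L r \<longleftrightarrow>
    r \<subseteq> carrier L \<times> carrier L \<and>
    (\<forall>m n. (m, n) \<in> r \<longrightarrow> m \<sqsubseteq>\<^bsub>L\<^esub> n) \<and>
    (\<forall>m\<in>carrier L. \<forall>n p. \<forall>q\<in>carrier L.
      m \<sqsubseteq>\<^bsub>L\<^esub> n \<and> (n, p) \<in> r \<and> p \<sqsubseteq>\<^bsub>L\<^esub> q \<longrightarrow> (m, q) \<in> r)"

definition inf_preserving :: "('b, 'z) gorder_scheme \<Rightarrow> 'b rel \<Rightarrow> bool" where
  "inf_preserving L r \<longleftrightarrow>
    (\<forall>m\<in>carrier L. \<forall>N. N \<subseteq> carrier L \<and> (\<forall>n\<in>N. (m, n) \<in> r) \<longrightarrow> (m, \<Sqinter>\<^bsub>L\<^esub> N) \<in> r)"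

definition interpolates :: "'b rel \<Rightarrow> bool" where
  "interpolates r \<longleftrightarrow> (\<forall>m n. (m, n) \<in> r \<longrightarrow> (\<exists>p. (m, p) \<in> r \<and> (p, n) \<in> r))"

text \<open>Maps are extensional, so that equality of maps is equality on the carrier.\<close>

definition op_maps :: "('b, 'z) gorder_scheme \<Rightarrow> ('b \<Rightarrow> 'b) set" where
  "op_maps L = {U \<in> carrier L \<rightarrow>\<^sub>E carrier L. isotone L L U}"

definition map_le :: "('b, 'z) gorder_scheme \<Rightarrow> ('b \<Rightarrow> 'b) \<Rightarrow> ('b \<Rightarrow> 'b) \<Rightarrow> bool" where
  "map_le L U V \<longleftrightarrow> (\<forall>m\<in>carrier L. U m \<sqsubseteq>\<^bsub>L\<^esub> V m)"

definition map_meet :: "('b, 'z) gorder_scheme \<Rightarrow> ('b \<Rightarrow> 'b) \<Rightarrow> ('b \<Rightarrow> 'b) \<Rightarrow> 'b \<Rightarrow> 'b" where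
  "map_meet L U V = (\<lambda>m\<in>carrier L. U m \<sqinter>\<^bsub>L\<^esub> V m)"

definition rel_map :: "('b, 'z) gorder_scheme \<Rightarrow> 'b rel \<Rightarrow> 'b \<Rightarrow> 'b" where
  "rel_map L r = (\<lambda>m\<in>carrier L. \<Sqinter>\<^bsub>L\<^esub> {n. (m, n) \<in> r})"


section \<open>Syntopogenous structures and quasi-uniformities\<close>

text \<open>
  In this section \<open>A\<close> is a subcategory of \<open>C\<close> (possibly \<open>C\<close> itself): families are indexed by
  the objects of \<open>A\<close> and the axioms on morphisms concern the arrows of \<open>A\<close>, while subobjects,
  images and inverse images are those of \<open>C\<close>.
\<close>

definition topogenous_order ::
  "('o, 'a, 'z) category_scheme \<Rightarrow> 'a set \<Rightarrow> ('o, 'a, 'y) category_scheme \<Rightarrow>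
    ('o \<Rightarrow> 'a set rel) \<Rightarrow> bool" where
  "topogenous_order C M A R \<longleftrightarrow>
    (\<forall>X\<in>Ob A. topogenous_rel (Sub C M X) (R X)) \<and>
    (\<forall>X Y. \<forall>f\<in>Hom A X Y. \<forall>m n.
      (m, n) \<in> R Y \<longrightarrow> (preimage_sub C f m, preimage_sub C f n) \<in> R X)"

text \<open>As for the families of maps below, the sets \<open>S X\<close> are not required to be nonempty.\<close>

definition syntopogenous ::
  "('o, 'a, 'z) category_scheme \<Rightarrow> 'a set \<Rightarrow> ('o, 'a, 'y) category_scheme \<Rightarrow>
    ('o \<Rightarrow> 'a set rel set) \<Rightarrow> bool" where
  "syntopogenous C M A S \<longleftrightarrow>
    (\<forall>X\<in>Ob A. \<forall>r\<in>S X. topogenous_rel (Sub C M X) r) \<and>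
    (\<forall>X\<in>Ob A. \<forall>r\<in>S X. \<forall>r'\<in>S X. \<exists>r''\<in>S X. r \<subseteq> r'' \<and> r' \<subseteq> r'') \<and>
    topogenous_order C M A (\<lambda>X. \<Union>(S X)) \<and>
    (\<forall>X\<in>Ob A. interpolates (\<Union>(S X)))"

definition co_perfect ::
  "('o, 'a, 'z) category_scheme \<Rightarrow> 'a set \<Rightarrow> ('o, 'a, 'y) category_scheme \<Rightarrow>
    ('o \<Rightarrow> 'a set rel set) \<Rightarrow> bool" where
  "co_perfect C M A S \<longleftrightarrow> (\<forall>X\<in>Ob A. \<forall>r\<in>S X. inf_preserving (Sub C M X) r)"

definition interpolative ::
  "('o, 'a, 'y) category_scheme \<Rightarrow> ('o \<Rightarrow> 'a set rel set) \<Rightarrow> bool" where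
  "interpolative A S \<longleftrightarrow> (\<forall>X\<in>Ob A. \<forall>r\<in>S X. interpolates r)"

text \<open>
  A base is closed under pointwise binary meets; a quasi-uniformity is in addition upward closed.
\<close>

definition qu_base ::
  "('o, 'a, 'z) category_scheme \<Rightarrow> 'a set \<Rightarrow> 'a set \<Rightarrow> ('o, 'a, 'y) category_scheme \<Rightarrow>
    ('o \<Rightarrow> ('a set \<Rightarrow> 'a set) set) \<Rightarrow> bool" where
  "qu_base C E M A B \<longleftrightarrow>
    (\<forall>X\<in>Ob A. B X \<subseteq> op_maps (Sub C M X)) \<and>
    (\<forall>X\<in>Ob A. \<forall>U\<in>B X. \<forall>m\<in>carrier (Sub C M X). m \<sqsubseteq>\<^bsub>Sub C M X\<^esub> U m) \<and>
    (\<forall>X\<in>Ob A. \<forall>U\<in>B X. \<exists>U'\<in>B X.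
      map_le (Sub C M X) (compose (carrier (Sub C M X)) U' U') U) \<and>
    (\<forall>X\<in>Ob A. \<forall>U\<in>B X. \<forall>U'\<in>B X. map_meet (Sub C M X) U U' \<in> B X) \<and>
    (\<forall>X Y. \<forall>f\<in>Hom A X Y. \<forall>U\<in>B Y. \<exists>U'\<in>B X. \<forall>m\<in>carrier (Sub C M X).
      image_sub C E M f (U' m) \<sqsubseteq>\<^bsub>Sub C M Y\<^esub> U (image_sub C E M f m))"

definition quasi_uniformity ::
  "('o, 'a, 'z) category_scheme \<Rightarrow> 'a set \<Rightarrow> 'a set \<Rightarrow> ('o, 'a, 'y) category_scheme \<Rightarrow>
    ('o \<Rightarrow> ('a set \<Rightarrow> 'a set) set) \<Rightarrow> bool" where
  "quasi_uniformity C E M A Q \<longleftrightarrow>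
    qu_base C E M A Q \<and>
    (\<forall>X\<in>Ob A. \<forall>U\<in>Q X. \<forall>U'\<in>op_maps (Sub C M X). map_le (Sub C M X) U U' \<longrightarrow> U' \<in> Q X)"

definition generated_qu ::
  "('o, 'a, 'z) category_scheme \<Rightarrow> 'a set \<Rightarrow> ('o \<Rightarrow> ('a set \<Rightarrow> 'a set) set) \<Rightarrow>
    'o \<Rightarrow> ('a set \<Rightarrow> 'a set) set" where
  "generated_qu C M B X = {V \<in> op_maps (Sub C M X). \<exists>U\<in>B X. map_le (Sub C M X) U V}"

definition transitive_base ::
  "('o, 'a, 'z) category_scheme \<Rightarrow> 'a set \<Rightarrow> 'a set \<Rightarrow> ('o, 'a, 'y) category_scheme \<Rightarrow>
    ('o \<Rightarrow> ('a set \<Rightarrow> 'a set) set) \<Rightarrow> bool" where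
  "transitive_base C E M A B \<longleftrightarrow>
    qu_base C E M A B \<and> (\<forall>X\<in>Ob A. \<forall>U\<in>B X. compose (carrier (Sub C M X)) U U = U)"

definition coarser ::
  "('o, 'a, 'z) category_scheme \<Rightarrow> 'a set \<Rightarrow> ('o, 'a, 'y) category_scheme \<Rightarrow>
    ('o \<Rightarrow> ('a set \<Rightarrow> 'a set) set) \<Rightarrow> ('o \<Rightarrow> ('a set \<Rightarrow> 'a set) set) \<Rightarrow> bool" where
  "coarser C M A Q Q' \<longleftrightarrow> (\<forall>X\<in>Ob A. \<forall>U\<in>Q X. \<exists>V\<in>Q' X. map_le (Sub C M X) V U)"

definition qu_continuous ::
  "('o, 'a, 'z) category_scheme \<Rightarrow> 'a set \<Rightarrow> 'a set \<Rightarrow> 'a \<Rightarrow>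
    ('o \<Rightarrow> ('a set \<Rightarrow> 'a set) set) \<Rightarrow> ('o \<Rightarrow> ('a set \<Rightarrow> 'a set) set) \<Rightarrow> bool" where
  "qu_continuous C E M f V U \<longleftrightarrow>
    (\<forall>u\<in>U (Cod C f). \<exists>v\<in>V (Dom C f). \<forall>m\<in>carrier (Sub C M (Dom C f)).
      image_sub C E M f (v m) \<sqsubseteq>\<^bsub>Sub C M (Cod C f)\<^esub> u (image_sub C E M f m))"

definition synt_base ::
  "('o, 'a, 'z) category_scheme \<Rightarrow> 'a set \<Rightarrow> ('o \<Rightarrow> 'a set rel set) \<Rightarrow>
    'o \<Rightarrow> ('a set \<Rightarrow> 'a set) set" where
  "synt_base C M S X = rel_map (Sub C M X) ` S X"


section \<open>Reflective subcategories\<close>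

text \<open>
  The subcategory need not be full. The reflector \<open>F\<close> is given by its object part \<open>Fo\<close> and
  its arrow part \<open>Fa\<close>.
\<close>

locale reflective_subcategory = category C + A: category A
  for C :: "('o, 'a, 'z) category_scheme" and A :: "('o, 'a, 'y) category_scheme" +
  fixes Fo :: "'o \<Rightarrow> 'o" and Fa :: "'a \<Rightarrow> 'a" and \<eta> :: "'o \<Rightarrow> 'a"
  assumes Ob_sub: "Ob A \<subseteq> Ob C"
    and Ar_sub: "Ar A \<subseteq> Ar C"
    and Dom_sub: "f \<in> Ar A \<Longrightarrow> Dom A f = Dom C f"
    and Cod_sub: "f \<in> Ar A \<Longrightarrow> Cod A f = Cod C f"
    and Id_sub: "X \<in> Ob A \<Longrightarrow> Id A X = Id C X"
    and Comp_sub: "\<lbrakk>f \<in> Hom A X Y; g \<in> Hom A Y Z\<rbrakk> \<Longrightarrow> g \<cdot>\<^bsub>A\<^esub> f = g \<cdot>\<^bsub>C\<^esub> f"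
    and Fo_Ob: "X \<in> Ob C \<Longrightarrow> Fo X \<in> Ob A"
    and Fa_Hom: "f \<in> Hom C X Y \<Longrightarrow> Fa f \<in> Hom A (Fo X) (Fo Y)"
    and Fa_Id: "X \<in> Ob C \<Longrightarrow> Fa (Id C X) = Id A (Fo X)"
    and Fa_Comp: "\<lbrakk>f \<in> Hom C X Y; g \<in> Hom C Y Z\<rbrakk> \<Longrightarrow> Fa (g \<cdot>\<^bsub>C\<^esub> f) = Fa g \<cdot>\<^bsub>A\<^esub> Fa f"
    and eta_Hom: "X \<in> Ob C \<Longrightarrow> \<eta> X \<in> Hom C X (Fo X)"
    and eta_natural: "f \<in> Hom C X Y \<Longrightarrow> \<eta> Y \<cdot>\<^bsub>C\<^esub> f = Fa f \<cdot>\<^bsub>C\<^esub> \<eta> X"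
    and eta_universal: "\<lbrakk>X \<in> Ob C; Y \<in> Ob A; f \<in> Hom C X Y\<rbrakk>
      \<Longrightarrow> \<exists>!g. g \<in> Hom A (Fo X) Y \<and> g \<cdot>\<^bsub>C\<^esub> \<eta> X = f"

definition refl_rel ::
  "('o, 'a, 'z) category_scheme \<Rightarrow> 'a set \<Rightarrow> 'a set \<Rightarrow> ('o \<Rightarrow> 'o) \<Rightarrow> ('o \<Rightarrow> 'a) \<Rightarrow> 'o \<Rightarrow>
    'a set rel \<Rightarrow> 'a set rel" where
  "refl_rel C E M Fo \<eta> X r =
    {(m, n). m \<in> carrier (Sub C M X) \<and> n \<in> carrier (Sub C M X) \<and>
      (\<exists>p\<in>carrier (Sub C M (Fo X)).
        (image_sub C E M (\<eta> X) m, p) \<in> r \<and> preimage_sub C (\<eta> X) p \<sqsubseteq>\<^bsub>Sub C M X\<^esub> n)}"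

definition refl_synt ::
  "('o, 'a, 'z) category_scheme \<Rightarrow> 'a set \<Rightarrow> 'a set \<Rightarrow> ('o \<Rightarrow> 'o) \<Rightarrow> ('o \<Rightarrow> 'a) \<Rightarrow>
    ('o \<Rightarrow> 'a set rel set) \<Rightarrow> 'o \<Rightarrow> 'a set rel set" where
  "refl_synt C E M Fo \<eta> S X = refl_rel C E M Fo \<eta> X ` S (Fo X)"

definition refl_base ::
  "('o, 'a, 'z) category_scheme \<Rightarrow> 'a set \<Rightarrow> 'a set \<Rightarrow> ('o \<Rightarrow> 'o) \<Rightarrow> ('o \<Rightarrow> 'a) \<Rightarrow>
    ('o \<Rightarrow> 'a set rel set) \<Rightarrow> 'o \<Rightarrow> ('a set \<Rightarrow> 'a set) set" where
  "refl_base C E M Fo \<eta> S X =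
    (\<lambda>U. \<lambda>m\<in>carrier (Sub C M X). preimage_sub C (\<eta> X) (U (image_sub C E M (\<eta> X) m)))
      ` synt_base C M S (Fo X)"

end

theory Submission
  imports Defs
begin

text \<open>
  Taking images along \<open>f\<close> is left adjoint to taking inverse images, since for \<open>M\<close>-morphisms both
  \<open>f(m) \<le> n\<close> and \<open>m \<le> f\<^sup>-\<^sup>1(n)\<close> say that the composite of \<open>m\<close> with \<open>f\<close> factors through \<open>n\<close>. Hence
  \<open>V(m) \<le> f\<^sup>-\<^sup>1(U(f(m)))\<close> holds iff \<open>f(V(m)) \<le> U(f(m))\<close>: the pulled back maps are the largest
  ones satisfying the continuity condition, which gives the coarsest structure. Axiom (U5) for a
  morphism \<open>f\<close> of \<open>C\<close> is (U5) for its reflection, transported along the naturality of \<open>\<eta>\<close>.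
\<close>

section \<open>Factoring through monomorphisms\<close>

text \<open>Everything about subobjects is reduced to the one relation
  \<open>factors_through\<close>. A subobject is an isomorphism class, while
  \<open>image_sub\<close> and \<open>preimage_sub\<close> collect the \<open>M\<close>-parts and
  the pullbacks of all representatives, so the first obstacle is that each collection is again a
  single class. This is settled by testing: an inverse image is determined by the morphisms that
  factor through it, an image by the \<open>M\<close>-morphisms through which it factors. The second
  test also shows that images are functorial, without which naturality of \<open>\<eta>\<close>
  could not be used on subobjects. The base axioms, continuity and minimality are proved for an
  arbitrary base \<open>B\<close> on \<open>A\<close>. The relations themselves return for
  transitivity, because interpolation speaks of them and not of the maps.\<close>

context category
begin

lemma HomI: "f \<in> Ar C \<Longrightarrow> f \<in> Hom C (Dom C f) (Cod C f)"
  by (simp add: Hom_def)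

lemma HomD:
  assumes "f \<in> Hom C X Y"
  shows "f \<in> Ar C" "Dom C f = X" "Cod C f = Y" "X \<in> Ob C" "Y \<in> Ob C"
  using assms Dom_Ob Cod_Ob by (auto simp: Hom_def)

text \<open>The factorization axiom provides composable factors and an equation; their outer domain
  and codomain have to be read off from the composite.\<close>

lemma Comp_eq_Hom:
  assumes "n \<in> Ar C" "e \<in> Ar C" "Cod C e = Dom C n" "n \<cdot> e \<in> Hom C X Y"
  shows "e \<in> Hom C X (Dom C n)" "n \<in> Hom C (Dom C n) Y"
proof -
  have "n \<cdot> e \<in> Hom C (Dom C e) (Cod C n)"
    using assms HomI Comp_Hom by metis
  then show "e \<in> Hom C X (Dom C n)" "n \<in> Hom C (Dom C n) Y"
    using assms by (auto simp: Hom_def)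
qed

lemma factors_through_refl: "m \<in> Ar C \<Longrightarrow> factors_through C m m"
  unfolding factors_through_def using HomI Id_Hom Id_right Dom_Ob by metis

lemma factors_through_comp:
  assumes "factors_through C n m" "m \<in> Hom C V X" "n \<in> Hom C W X" "g \<in> Hom C Z W"
  shows "factors_through C (n \<cdot> g) m"
proof -
  obtain j where j: "j \<in> Hom C W V" "m \<cdot> j = n"
    using assms by (auto simp: factors_through_def Hom_def)
  have "m \<cdot> (j \<cdot> g) = n \<cdot> g"
    using Comp_assoc[OF assms(4) j(1) assms(2)] j(2) by simp
  moreover have "j \<cdot> g \<in> Hom C Z V" "n \<cdot> g \<in> Hom C Z X"
    using Comp_Hom assms j by blast+
  ultimately show ?thesis
    using assms HomD unfolding factors_through_def by metis
qed

lemma factors_through_trans: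
  assumes "factors_through C k n" "factors_through C n m"
    and "k \<in> Hom C U X" "n \<in> Hom C W X" "m \<in> Hom C V X"
  shows "factors_through C k m"
proof -
  obtain j where "j \<in> Hom C U W" "n \<cdot> j = k"
    using assms by (auto simp: factors_through_def Hom_def)
  then show ?thesis
    using factors_through_comp[OF assms(2,5,4)] by blast
qed

text \<open>Composing either side with \<open>m\<close> gives \<open>m\<close>, and \<open>m\<close>
  can be cancelled.\<close>

lemma mono_inverse:
  assumes "mono_in C m" "mono_in C n" "Cod C m = Cod C n"
    and j: "j \<in> Hom C (Dom C n) (Dom C m)" "m \<cdot> j = n"
    and k: "k \<in> Hom C (Dom C m) (Dom C n)" "n \<cdot> k = m"
  shows "j \<cdot> k = Id C (Dom C m)"
proof -
  have m: "m \<in> Hom C (Dom C m) (Cod C m)"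
    using assms(1) HomI by (auto simp: mono_in_def)
  have "m \<cdot> (j \<cdot> k) = m \<cdot> Id C (Dom C m)"
    using Comp_assoc[OF k(1) j(1) m] j k Id_right[OF m] by simp
  moreover have "j \<cdot> k \<in> Hom C (Dom C m) (Dom C m)"
    using Comp_Hom j k by blast
  moreover have "Id C (Dom C m) \<in> Hom C (Dom C m) (Dom C m)"
    using m HomD Id_Hom by blast
  ultimately show ?thesis
    using assms(1) unfolding mono_in_def by blast
qed

text \<open>Two factorizations between monomorphisms are automatically mutually inverse. This
  replaces isomorphisms by the preorder \<open>factors_through\<close> in all later
  arguments.\<close>

lemma iso_iff_factors_through:
  assumes m: "mono_in C m" and n: "mono_in C n" and c: "Cod C m = Cod C n"
  shows "(\<exists>h\<in>Hom C (Dom C n) (Dom C m). iso_in C h \<and> m \<cdot> h = n) \<longleftrightarrow>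
    factors_through C m n \<and> factors_through C n m" (is "?I \<longleftrightarrow> ?F")
proof
  assume ?I
  then obtain h k where h: "h \<in> Hom C (Dom C n) (Dom C m)" "m \<cdot> h = n"
    and k: "k \<in> Hom C (Dom C m) (Dom C n)" "h \<cdot> k = Id C (Dom C m)"
    unfolding iso_in_def using HomD by metis
  have mH: "m \<in> Hom C (Dom C m) (Cod C m)"
    using m HomI by (auto simp: mono_in_def)
  have "n \<cdot> k = m"
    using Comp_assoc[OF k(1) h(1) mH] h k Id_right[OF mH] by simp
  then show ?F
    using h k unfolding factors_through_def by blast
next
  assume ?F
  then obtain j k where j: "j \<in> Hom C (Dom C n) (Dom C m)" "m \<cdot> j = n"
    and k: "k \<in> Hom C (Dom C m) (Dom C n)" "n \<cdot> k = m"
    unfolding factors_through_def by blast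
  have "iso_in C j"
    unfolding iso_in_def
    using mono_inverse[OF m n c j k] mono_inverse[OF n m c[symmetric] k j] j(1) k(1) HomD
    by metis
  then show ?I
    using j by blast
qed

text \<open>A factorization of \<open>f \<cdot> g\<close> through \<open>n\<close> is the second leg
  of a cone whose first leg is \<open>g\<close>. This is the form in which the universal property of
  the pullback enters the adjunction.\<close>

lemma factors_through_pullback_iff:
  assumes pb: "is_pullback C f n f' n'" and g: "g \<in> Hom C W (Dom C f)"
  shows "factors_through C g n' \<longleftrightarrow> factors_through C (f \<cdot> g) n"
proof -
  have f: "f \<in> Hom C (Dom C f) (Cod C f)" and n: "n \<in> Hom C (Dom C n) (Cod C f)"
    and f': "f' \<in> Hom C (Dom C n') (Dom C n)" and n': "n' \<in> Hom C (Dom C n') (Dom C f)"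
    and sq: "f \<cdot> n' = n \<cdot> f'"
    using pb HomI unfolding is_pullback_def by metis+
  have fg: "f \<cdot> g \<in> Hom C W (Cod C f)"
    using Comp_Hom f g by blast
  show ?thesis
  proof
    assume "factors_through C g n'"
    then obtain u where u: "u \<in> Hom C W (Dom C n')" "n' \<cdot> u = g"
      using g by (auto simp: factors_through_def Hom_def)
    have "n \<cdot> (f' \<cdot> u) = f \<cdot> g"
      using Comp_assoc[OF u(1) f' n] Comp_assoc[OF u(1) n' f] sq u by simp
    moreover have "f' \<cdot> u \<in> Hom C W (Dom C n)"
      using Comp_Hom u f' by blast
    ultimately show "factors_through C (f \<cdot> g) n"
      using HomD(2)[OF fg] unfolding factors_through_def by blast
  next
    assume "factors_through C (f \<cdot> g) n"
    then obtain k where "k \<in> Hom C W (Dom C n)" "n \<cdot> k = f \<cdot> g"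
      using fg by (auto simp: factors_through_def Hom_def)
    then obtain u where "u \<in> Hom C W (Dom C n')" "n' \<cdot> u = g"
      using pb g unfolding is_pullback_def by metis
    then show "factors_through C g n'"
      using HomD(2)[OF g] unfolding factors_through_def by blast
  qed
qed

text \<open>Converse of the preceding criterion for monomorphisms: the factorization test already
  gives a mediating morphism, cancelling \<open>n\<close> makes it compatible with
  \<open>f'\<close>, and cancelling \<open>n'\<close> makes it unique.\<close>

lemma is_pullback_monoI:
  assumes f: "f \<in> Hom C X Y" and n: "mono_in C n" "Cod C n = Y"
    and n': "mono_in C n'" "Cod C n' = X"
    and iff: "\<And>W g. g \<in> Hom C W X \<Longrightarrow> factors_through C g n' \<longleftrightarrow> factors_through C (f \<cdot> g) n"
  shows "\<exists>f'. is_pullback C f n f' n'"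
proof -
  have nH: "n \<in> Hom C (Dom C n) Y" and n'H: "n' \<in> Hom C (Dom C n') X"
    using n n' by (auto simp: mono_in_def Hom_def)
  have fn': "f \<cdot> n' \<in> Hom C (Dom C n') Y"
    using Comp_Hom f n'H by blast
  \<comment> \<open>The missing leg \<open>f'\<close> comes from applying the test to
    \<open>n'\<close> itself.\<close>
  have "factors_through C (f \<cdot> n') n"
    using iff[OF n'H] factors_through_refl HomD[OF n'H] by blast
  then obtain f' where f': "f' \<in> Hom C (Dom C n') (Dom C n)" "n \<cdot> f' = f \<cdot> n'"
    using fn' by (auto simp: factors_through_def Hom_def)
  have "\<exists>!u. u \<in> Hom C W (Dom C n') \<and> n' \<cdot> u = h \<and> f' \<cdot> u = k"
    if h: "h \<in> Hom C W X" and k: "k \<in> Hom C W (Dom C n)" and eq: "f \<cdot> h = n \<cdot> k" for W h k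
  proof -
    have "f \<cdot> h \<in> Hom C W Y"
      using Comp_Hom f h by blast
    then have "factors_through C (f \<cdot> h) n"
      using k eq by (auto simp: factors_through_def Hom_def)
    then have "factors_through C h n'"
      using iff[OF h] by blast
    then obtain u where u: "u \<in> Hom C W (Dom C n')" "n' \<cdot> u = h"
      using h by (auto simp: factors_through_def Hom_def)
    have "n \<cdot> (f' \<cdot> u) = n \<cdot> k"
      using Comp_assoc[OF u(1) f'(1) nH] Comp_assoc[OF u(1) n'H f] f' u eq by simp
    moreover have "f' \<cdot> u \<in> Hom C W (Dom C n)"
      using Comp_Hom u f' by blast
    ultimately have "f' \<cdot> u = k"
      using n(1) k unfolding mono_in_def by blast
    then show ?thesis
      using u n'(1) unfolding mono_in_def by blast
  qed
  then have "is_pullback C f n f' n'"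
    unfolding is_pullback_def using f f' n n'H nH by (auto simp: Hom_def)
  then show ?thesis ..
qed

end

section \<open>Subobjects and the image adjunction\<close>

context M_complete_category
begin

lemma M_Hom: "m \<in> M \<Longrightarrow> m \<in> Hom C (Dom C m) (Cod C m)"
  using M_mono HomI by (auto simp: mono_in_def)

lemma M_HomI: "\<lbrakk>m \<in> M; Cod C m = X\<rbrakk> \<Longrightarrow> m \<in> Hom C (Dom C m) X"
  using M_Hom by blast

lemma E_Hom: "e \<in> E \<Longrightarrow> e \<in> Hom C (Dom C e) (Cod C e)"
  using E_epi HomI by (auto simp: epi_in_def)

lemma M_factors_through_refl: "m \<in> M \<Longrightarrow> factors_through C m m"
  using factors_through_refl M_HomI HomD(1) by blast

lemma M_factors_through_trans:
  assumes "factors_through C k n" "factors_through C n m"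
    and "k \<in> M" "n \<in> M" "m \<in> M" "Cod C k = X" "Cod C n = X" "Cod C m = X"
  shows "factors_through C k m"
  using assms M_Hom factors_through_trans by metis

section \<open>Subobjects as a complete lattice\<close>

lemma sub_iso_iff:
  "(m, n) \<in> sub_iso C M X \<longleftrightarrow> m \<in> M \<and> n \<in> M \<and> Cod C m = X \<and> Cod C n = X \<and>
    factors_through C m n \<and> factors_through C n m"
proof (cases "m \<in> M \<and> n \<in> M \<and> Cod C m = X \<and> Cod C n = X")
  case True
  then show ?thesis
    using iso_iff_factors_through[of m n] M_mono by (simp add: sub_iso_def)
qed (auto simp: sub_iso_def)

lemma equiv_sub_iso: "equiv {m \<in> M. Cod C m = X} (sub_iso C M X)"
proof (rule equivI)
  show "refl_on {m \<in> M. Cod C m = X} (sub_iso C M X)"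
    by (intro refl_onI) (simp add: sub_iso_iff M_factors_through_refl)
  show "sym (sub_iso C M X)"
    by (auto simp: sym_def sub_iso_iff)
  show "trans (sub_iso C M X)"
    unfolding trans_def sub_iso_iff using M_factors_through_trans by metis
  show "sub_iso C M X \<subseteq> {m \<in> M. Cod C m = X} \<times> {m \<in> M. Cod C m = X}"
    by (auto simp: sub_iso_iff)
qed

abbreviation sub_class :: "'o \<Rightarrow> 'a \<Rightarrow> 'a set" where
  "sub_class X m \<equiv> sub_iso C M X `` {m}"

lemma sub_class_carrier: "\<lbrakk>m \<in> M; Cod C m = X\<rbrakk> \<Longrightarrow> sub_class X m \<in> carrier (Sub C M X)"
  by (auto simp: Sub_def intro: quotientI)

lemma sub_class_self: "\<lbrakk>m \<in> M; Cod C m = X\<rbrakk> \<Longrightarrow> m \<in> sub_class X m"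
  by (simp add: sub_iso_iff M_factors_through_refl)

lemma Sub_cases:
  assumes "s \<in> carrier (Sub C M X)"
  obtains m where "m \<in> M" "Cod C m = X" "s = sub_class X m" "m \<in> s"
proof -
  obtain m where "m \<in> M" "Cod C m = X" "s = sub_class X m"
    using assms by (auto simp: Sub_def quotient_def)
  then show ?thesis
    using that sub_class_self by blast
qed

text \<open>The order on classes is defined by the existence of suitable representatives; mutual
  factorization within a class makes it independent of their choice.\<close>

lemma sub_class_le_iff:
  assumes "n \<in> M" "Cod C n = X" "m \<in> M" "Cod C m = X"
  shows "sub_class X n \<sqsubseteq>\<^bsub>Sub C M X\<^esub> sub_class X m \<longleftrightarrow> factors_through C n m"
proof
  assume "sub_class X n \<sqsubseteq>\<^bsub>Sub C M X\<^esub> sub_class X m"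
  then obtain n1 m1 where "(n, n1) \<in> sub_iso C M X" "(m, m1) \<in> sub_iso C M X"
    "factors_through C n1 m1"
    by (auto simp: Sub_def)
  then show "factors_through C n m"
    unfolding sub_iso_iff using M_factors_through_trans by metis
next
  assume "factors_through C n m"
  then show "sub_class X n \<sqsubseteq>\<^bsub>Sub C M X\<^esub> sub_class X m"
    unfolding Sub_def using sub_class_self assms by (simp del: Image_singleton_iff) blast
qed

lemma sub_class_eqI:
  assumes "n \<in> M" "Cod C n = X" "m \<in> M" "Cod C m = X"
    and "factors_through C n m" "factors_through C m n"
  shows "sub_class X n = sub_class X m"
  using equiv_class_eq[OF equiv_sub_iso] assms sub_iso_iff by blast

lemma partial_order_Sub: "partial_order (Sub C M X)"
proof
  fix s t u
  assume "s \<in> carrier (Sub C M X)" "t \<in> carrier (Sub C M X)" "u \<in> carrier (Sub C M X)"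
    and "s \<sqsubseteq>\<^bsub>Sub C M X\<^esub> t" "t \<sqsubseteq>\<^bsub>Sub C M X\<^esub> u"
  then show "s \<sqsubseteq>\<^bsub>Sub C M X\<^esub> u"
    by (elim Sub_cases) (metis sub_class_le_iff M_factors_through_trans)
next
  fix s t
  assume "s \<sqsubseteq>\<^bsub>Sub C M X\<^esub> t" "t \<sqsubseteq>\<^bsub>Sub C M X\<^esub> s"
    and "s \<in> carrier (Sub C M X)" "t \<in> carrier (Sub C M X)"
  then have "s = t"
    by (elim Sub_cases) (metis sub_class_le_iff sub_class_eqI)
  then show "s .=\<^bsub>Sub C M X\<^esub> t"
    by (simp add: Sub_def)
next
  fix s
  assume "s \<in> carrier (Sub C M X)"
  then show "s \<sqsubseteq>\<^bsub>Sub C M X\<^esub> s"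
    by (elim Sub_cases) (metis sub_class_le_iff M_factors_through_refl)
qed (auto simp: Sub_def)

lemma complete_lattice_Sub:
  assumes X: "X \<in> Ob C"
  shows "complete_lattice (Sub C M X)"
proof -
  interpret partial_order "Sub C M X"
    by (rule partial_order_Sub)
  have glb: "\<exists>i. greatest (Sub C M X) i (Lower (Sub C M X) N)"
    if N: "N \<subseteq> carrier (Sub C M X)" for N
  proof -
    \<comment> \<open>The union contains every representative of every member of \<open>N\<close>,
      so no representatives have to be chosen before intersecting.\<close>
    have UN: "\<Union>N \<subseteq> {m \<in> M. Cod C m = X}"
      using N by (auto simp: Sub_def quotient_def sub_iso_iff)
    obtain p where p: "is_intersection C X (\<Union>N) p"
      using M_intersection_ex[OF X UN] by blast
    have pM: "p \<in> M" "Cod C p = X"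
      using M_intersection_M[OF X UN p] p by (auto simp: is_intersection_def Hom_def)
    have "greatest (Sub C M X) (sub_class X p) (Lower (Sub C M X) N)"
    proof (rule greatest_LowerI)
      fix s assume s: "s \<in> N"
      then obtain m where m: "m \<in> M" "Cod C m = X" "s = sub_class X m" "m \<in> s"
        using N Sub_cases by blast
      have "factors_through C p m"
        using p m s unfolding is_intersection_def by blast
      then show "sub_class X p \<sqsubseteq>\<^bsub>Sub C M X\<^esub> s"
        using m pM sub_class_le_iff by blast
    next
      fix t assume t: "t \<in> Lower (Sub C M X) N"
      then obtain q where q: "q \<in> M" "Cod C q = X" "t = sub_class X q"
        using Sub_cases[of t X] by (auto simp: Lower_def)
      have "factors_through C q n" if n: "n \<in> \<Union>N" for n
      proof -
        obtain s where s: "s \<in> N" "n \<in> s"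
          using n by blast
        then obtain m where m: "m \<in> M" "Cod C m = X" "s = sub_class X m"
          using N Sub_cases by blast
        have "t \<sqsubseteq>\<^bsub>Sub C M X\<^esub> s"
          using t s N by (auto simp: Lower_def)
        then have "factors_through C q m"
          using sub_class_le_iff m q by blast
        moreover have "(m, n) \<in> sub_iso C M X"
          using s m by blast
        ultimately show ?thesis
          unfolding sub_iso_iff using M_factors_through_trans q by metis
      qed
      moreover have "q \<in> Hom C (Dom C q) X"
        using q M_HomI by blast
      ultimately have "\<exists>!u. u \<in> Hom C (Dom C q) (Dom C p) \<and> p \<cdot> u = q"
        using p unfolding is_intersection_def by metis
      then have "factors_through C q p"
        unfolding factors_through_def by (blast elim: ex1E)
      then show "t \<sqsubseteq>\<^bsub>Sub C M X\<^esub> sub_class X p"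
        using pM q sub_class_le_iff by blast
    qed (use N pM sub_class_carrier in auto)
    then show ?thesis ..
  qed
  \<comment> \<open>The intersection of the empty family is the top element.\<close>
  have "\<exists>g. greatest (Sub C M X) g (carrier (Sub C M X))"
    using glb[of "{}"] by (simp add: Lower_empty)
  then show ?thesis
    by (rule complete_lattice_criterion1) (rule glb)
qed

text \<open>This use of orthogonality spares showing that \<open>E\<close> is closed under composition.\<close>

lemma factors_through_E_comp_iff:
  assumes e: "e \<in> E" and h: "h \<in> Hom C (Cod C e) Z" and l: "l \<in> M" "Cod C l = Z"
  shows "factors_through C (h \<cdot> e) l \<longleftrightarrow> factors_through C h l"
proof
  have he: "h \<cdot> e \<in> Hom C (Dom C e) Z"
    using Comp_Hom E_Hom e h by blast
  assume "factors_through C (h \<cdot> e) l"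
  then obtain j where "j \<in> Hom C (Dom C e) (Dom C l)" "l \<cdot> j = h \<cdot> e"
    using he by (auto simp: factors_through_def Hom_def)
  then obtain d where "d \<in> Hom C (Cod C e) (Dom C l)" "l \<cdot> d = h"
    using diagonal[OF e l(1)] h l by blast
  then show "factors_through C h l"
    using h by (auto simp: factors_through_def Hom_def)
next
  assume "factors_through C h l"
  then show "factors_through C (h \<cdot> e) l"
    using factors_through_comp M_HomI E_Hom e h l by blast
qed

section \<open>Images of subobjects\<close>

text \<open>Any two \<open>M\<close>-parts obtained from representatives of the same subobject
  factor through the same \<open>M\<close>-morphisms, hence through each other. Conversely, every
  member of the class of \<open>n\<close> is an \<open>M\<close>-part, because an isomorphism can be
  absorbed into the \<open>E\<close>-part.\<close>

lemma image_sub_class: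
  assumes m: "m \<in> M" "Cod C m = X" and f: "f \<in> Hom C X Y"
    and n: "n \<in> M" and e: "e \<in> E" "Cod C e = Dom C n" "n \<cdot> e = f \<cdot> m"
  shows "image_sub C E M f (sub_class X m) = sub_class Y n"
proof -
  \<comment> \<open>Orthogonality cancels \<open>e'\<close>, so \<open>n'\<close> lies below exactly
    those \<open>k\<close> through which \<open>f \<cdot> m'\<close> factors.\<close>
  have fac: "Cod C n' = Y \<and> (\<forall>k\<in>M. Cod C k = Y \<longrightarrow>
      factors_through C (f \<cdot> m') k = factors_through C n' k)"
    if m': "m' \<in> M" "Cod C m' = X" and n': "n' \<in> M"
      and e': "e' \<in> E" "Cod C e' = Dom C n'" "n' \<cdot> e' = f \<cdot> m'" for m' n' e'
  proof -
    have "n' \<cdot> e' \<in> Hom C (Dom C m') Y"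
      using Comp_Hom M_Hom m' f e' by metis
    then have "n' \<in> Hom C (Dom C n') Y"
      using Comp_eq_Hom(2) n' e' M_HomI E_Hom HomD(1) by blast
    then show ?thesis
      using factors_through_E_comp_iff[OF e'(1)] e' by (metis HomD(3))
  qed
  have nY: "Cod C n = Y"
    using fac[OF m n e] by blast
  show ?thesis
  proof (intro equalityI subsetI)
    fix n' assume "n' \<in> image_sub C E M f (sub_class X m)"
    then obtain m' e' where n': "n' \<in> M" and mm': "(m, m') \<in> sub_iso C M X"
      and e': "e' \<in> E" "Cod C e' = Dom C n'" "n' \<cdot> e' = f \<cdot> m'"
      by (auto simp: image_sub_def)
    have m': "m' \<in> M" "Cod C m' = X"
      using mm' by (auto simp: sub_iso_iff)
    obtain h where h: "h \<in> Hom C (Dom C m') (Dom C m)" "m \<cdot> h = m'"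
      using mm' by (auto simp: sub_iso_def)
    obtain h' where h': "h' \<in> Hom C (Dom C m) (Dom C m')" "m' \<cdot> h' = m"
      using mm' by (auto simp: sub_iso_iff factors_through_def)
    have mH: "m \<in> Hom C (Dom C m) X" "m' \<in> Hom C (Dom C m') X"
      using M_HomI m m' by blast+
    have fm: "f \<cdot> m \<in> Hom C (Dom C m) Y" "f \<cdot> m' \<in> Hom C (Dom C m') Y"
      using Comp_Hom mH f by blast+
    \<comment> \<open>Changing the representative precomposes with \<open>h\<close> or
      \<open>h'\<close>, which preserves factorization in both directions.\<close>
    have "factors_through C (f \<cdot> m) k = factors_through C (f \<cdot> m') k"
      if k: "k \<in> M" "Cod C k = Y" for k
    proof -
      have "(f \<cdot> m) \<cdot> h = f \<cdot> m'" "(f \<cdot> m') \<cdot> h' = f \<cdot> m"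
        using Comp_assoc h h' mH f by metis+
      then show ?thesis
        using factors_through_comp M_Hom k fm h h' by metis
    qed
    then have "factors_through C n k = factors_through C n' k" if "k \<in> M" "Cod C k = Y" for k
      using fac[OF m n e] fac[OF m' n' e'] that by blast
    moreover have "Cod C n' = Y" "factors_through C n n" "factors_through C n' n'"
      using fac[OF m' n' e'] M_factors_through_refl n n' by blast+
    ultimately show "n' \<in> sub_class Y n"
      using n n' nY sub_iso_iff by blast
  next
    fix n' assume n': "n' \<in> sub_class Y n"
    then have "(n', n) \<in> sub_iso C M Y"
      by (auto simp: sub_iso_iff)
    then obtain h where h: "h \<in> Hom C (Dom C n) (Dom C n')" "iso_in C h" "n' \<cdot> h = n"
      and n'M: "n' \<in> M" "Cod C n' = Y"
      by (auto simp: sub_iso_def)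
    \<comment> \<open>The isomorphism that turns \<open>n\<close> into \<open>n'\<close> is moved
      into the \<open>E\<close>-part.\<close>
    have "h \<cdot> e \<in> E"
      using E_iso e h by (auto simp: Hom_def)
    moreover have eH: "e \<in> Hom C (Dom C e) (Dom C n)"
      using E_Hom e by metis
    moreover have "h \<cdot> e \<in> Hom C (Dom C e) (Dom C n')"
      using Comp_Hom eH h by blast
    moreover have "n' \<cdot> (h \<cdot> e) = f \<cdot> m"
      using Comp_assoc[OF eH h(1) M_Hom[OF n'M(1)]] h e by simp
    ultimately show "n' \<in> image_sub C E M f (sub_class X m)"
      using n'M m sub_class_self by (auto simp: image_sub_def Hom_def)
  qed
qed

lemma image_sub_cases:
  assumes s: "s \<in> carrier (Sub C M X)" and f: "f \<in> Hom C X Y"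
  obtains m n e where "m \<in> M" "Cod C m = X" "s = sub_class X m"
    and "n \<in> M" "Cod C n = Y" "e \<in> E" "Cod C e = Dom C n" "n \<cdot> e = f \<cdot> m"
    and "image_sub C E M f s = sub_class Y n"
proof -
  obtain m where m: "m \<in> M" "Cod C m = X" "s = sub_class X m"
    using s Sub_cases by blast
  have fm: "f \<cdot> m \<in> Hom C (Dom C m) Y"
    using Comp_Hom M_HomI f m by blast
  then obtain e n where en: "e \<in> E" "n \<in> M" "Cod C e = Dom C n" "n \<cdot> e = f \<cdot> m"
    using factorization HomD(1) by blast
  then have "n \<in> Hom C (Dom C n) Y"
    using Comp_eq_Hom(2) fm M_Hom E_Hom HomD(1) by metis
  then show ?thesis
    using that m en image_sub_class[OF m(1,2) f] HomD(3) by blast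
qed

lemma image_sub_carrier:
  "\<lbrakk>f \<in> Hom C X Y; s \<in> carrier (Sub C M X)\<rbrakk> \<Longrightarrow> image_sub C E M f s \<in> carrier (Sub C M Y)"
  by (erule image_sub_cases, assumption) (simp add: sub_class_carrier)

text \<open>Cancelling the \<open>E\<close>-part of \<open>f \<cdot> m = n \<cdot> e\<close> leaves
  the order relation between \<open>n\<close> and \<open>k\<close>. This is the half of the
  adjunction that concerns images.\<close>

lemma image_sub_le_iff:
  assumes f: "f \<in> Hom C X Y" and m: "m \<in> M" "Cod C m = X" and k: "k \<in> M" "Cod C k = Y"
  shows "image_sub C E M f (sub_class X m) \<sqsubseteq>\<^bsub>Sub C M Y\<^esub> sub_class Y k \<longleftrightarrow>
    factors_through C (f \<cdot> m) k"
proof -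
  have fm: "f \<cdot> m \<in> Hom C (Dom C m) Y"
    using Comp_Hom M_HomI f m by blast
  then obtain e n where en: "e \<in> E" "n \<in> M" "Cod C e = Dom C n" "n \<cdot> e = f \<cdot> m"
    using factorization HomD(1) by blast
  then have n: "n \<in> Hom C (Dom C n) Y"
    using Comp_eq_Hom(2) fm M_Hom E_Hom HomD(1) by metis
  have "factors_through C (f \<cdot> m) k = factors_through C n k"
    using factors_through_E_comp_iff[OF en(1)] en n k by metis
  then show ?thesis
    using image_sub_class[OF m f en(2,1,3,4)] sub_class_le_iff en n k HomD(3) by metis
qed

section \<open>Inverse images of subobjects\<close>

text \<open>Pullbacks of different representatives admit the same factorizing morphisms, so they
  factor through each other. Conversely, \<open>is_pullback_monoI\<close> makes every member of the
  class of \<open>n'\<close> a pullback of \<open>n\<close> itself.\<close>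

lemma preimage_sub_class:
  assumes f: "f \<in> Hom C X Y" and n: "n \<in> M" "Cod C n = Y" and pb: "is_pullback C f n f' n'"
  shows "preimage_sub C f (sub_class Y n) = sub_class X n'"
proof -
  have iff: "factors_through C g k = factors_through C (f \<cdot> g) n"
    if nn': "(n, n1) \<in> sub_iso C M Y" and k: "is_pullback C f n1 f1 k" and g: "g \<in> Hom C W X"
    for n1 f1 k g W
  proof -
    have "f \<cdot> g \<in> Hom C W Y"
      using Comp_Hom f g by blast
    moreover have "n \<in> Hom C (Dom C n) Y" "n1 \<in> Hom C (Dom C n1) Y"
      "factors_through C n n1" "factors_through C n1 n"
      using nn' M_Hom[of n] M_Hom[of n1] by (auto simp: sub_iso_iff)
    ultimately have "factors_through C (f \<cdot> g) n1 = factors_through C (f \<cdot> g) n"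
      using factors_through_trans by blast
    moreover have "factors_through C g k = factors_through C (f \<cdot> g) n1"
      using factors_through_pullback_iff[OF k] g f HomD(2) by metis
    ultimately show ?thesis by simp
  qed
  have pbM: "k \<in> M \<and> Cod C k = X"
    if "n1 \<in> M" "is_pullback C f n1 f1 k" for n1 f1 k
    using that M_pullback_M f by (auto simp: is_pullback_def Hom_def)
  have nn: "(n, n) \<in> sub_iso C M Y"
    using sub_class_self n by blast
  have n': "n' \<in> M" "Cod C n' = X"
    using pbM[OF n(1) pb] by auto
  show ?thesis
  proof (intro equalityI subsetI)
    fix k assume "k \<in> preimage_sub C f (sub_class Y n)"
    then obtain n1 f1 where n1: "(n, n1) \<in> sub_iso C M Y" and k: "is_pullback C f n1 f1 k"
      by (auto simp: preimage_sub_def)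
    have kM: "k \<in> M" "Cod C k = X"
      using pbM[OF _ k] n1 by (auto simp: sub_iso_iff)
    have "factors_through C g k = factors_through C g n'" if "g \<in> Hom C W X" for g W
      using iff[OF n1 k that] iff[OF nn pb that] by simp
    then have "factors_through C k n'" "factors_through C n' k"
      using M_HomI M_factors_through_refl kM n' by blast+
    then show "k \<in> sub_class X n'"
      using kM n' by (simp add: sub_iso_iff)
  next
    fix k assume "k \<in> sub_class X n'"
    then have k: "k \<in> M" "Cod C k = X" "factors_through C k n'" "factors_through C n' k"
      by (auto simp: sub_iso_iff)
    have "factors_through C g k = factors_through C (f \<cdot> g) n" if g: "g \<in> Hom C W X" for g W
    proof -
      have "factors_through C g k = factors_through C g n'"
        using factors_through_trans g k n' M_HomI by blast
      then show ?thesis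
        using iff[OF nn pb g] by simp
    qed
    then have "\<exists>f1. is_pullback C f n f1 k"
      using is_pullback_monoI[OF f M_mono[OF n(1)] n(2) M_mono[OF k(1)] k(2)] by blast
    then show "k \<in> preimage_sub C f (sub_class Y n)"
      using nn by (auto simp: preimage_sub_def)
  qed
qed

lemma preimage_sub_cases:
  assumes f: "f \<in> Hom C X Y" and n: "n \<in> M" "Cod C n = Y"
  obtains n' where "n' \<in> M" "Cod C n' = X" "preimage_sub C f (sub_class Y n) = sub_class X n'"
    and "\<forall>W. \<forall>g\<in>Hom C W X. factors_through C g n' \<longleftrightarrow> factors_through C (f \<cdot> g) n"
proof -
  obtain f' n' where pb: "is_pullback C f n f' n'"
    using M_pullback_ex[OF n(1) HomD(1)[OF f]] n(2) HomD(3)[OF f] by auto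
  have "n' \<in> M" "Cod C n' = X"
    using M_pullback_M n pb f by (auto simp: is_pullback_def Hom_def)
  moreover have "\<forall>W. \<forall>g\<in>Hom C W X. factors_through C g n' \<longleftrightarrow> factors_through C (f \<cdot> g) n"
    using factors_through_pullback_iff[OF pb] HomD(2)[OF f] by simp
  ultimately show ?thesis
    by (rule that[OF _ _ preimage_sub_class[OF f n pb]])
qed

lemma preimage_sub_carrier:
  assumes f: "f \<in> Hom C X Y" and t: "t \<in> carrier (Sub C M Y)"
  shows "preimage_sub C f t \<in> carrier (Sub C M X)"
proof -
  obtain n where n: "n \<in> M" "Cod C n = Y" "t = sub_class Y n"
    using t Sub_cases by blast
  show ?thesis
    by (rule preimage_sub_cases[OF f n(1,2)]) (simp add: n(3) sub_class_carrier)
qed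

section \<open>The adjunction and its formal consequences\<close>

lemma image_le_iff_le_preimage:
  assumes f: "f \<in> Hom C X Y" and s: "s \<in> carrier (Sub C M X)" and t: "t \<in> carrier (Sub C M Y)"
  shows "image_sub C E M f s \<sqsubseteq>\<^bsub>Sub C M Y\<^esub> t \<longleftrightarrow> s \<sqsubseteq>\<^bsub>Sub C M X\<^esub> preimage_sub C f t"
proof -
  obtain m where m: "m \<in> M" "Cod C m = X" "s = sub_class X m"
    using s Sub_cases by blast
  obtain n where n: "n \<in> M" "Cod C n = Y" "t = sub_class Y n"
    using t Sub_cases by blast
  obtain n' where n': "n' \<in> M" "Cod C n' = X"
    "preimage_sub C f (sub_class Y n) = sub_class X n'"
    and iff: "\<forall>W. \<forall>g\<in>Hom C W X. factors_through C g n' \<longleftrightarrow> factors_through C (f \<cdot> g) n"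
    using preimage_sub_cases[OF f n(1,2)] by blast
  have "m \<in> Hom C (Dom C m) X"
    using M_HomI m by blast
  then have "factors_through C m n' \<longleftrightarrow> factors_through C (f \<cdot> m) n"
    using iff by blast
  then show ?thesis
    unfolding m(3) n(3) n'(3) image_sub_le_iff[OF f m(1,2) n(1,2)] sub_class_le_iff[OF m(1,2) n'(1,2)]
    by simp
qed

text \<open>Elements of a partial order with the same upper bounds are equal. The upper bounds of
  either side are given by the \<open>l\<close> in \<open>M\<close> through which
  \<open>(g \<cdot> f) \<cdot> m\<close> factors.\<close>

lemma image_sub_comp:
  assumes f: "f \<in> Hom C X Y" and g: "g \<in> Hom C Y Z" and s: "s \<in> carrier (Sub C M X)"
  shows "image_sub C E M (g \<cdot> f) s = image_sub C E M g (image_sub C E M f s)"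
proof -
  interpret partial_order "Sub C M Z"
    by (rule partial_order_Sub)
  have gf: "g \<cdot> f \<in> Hom C X Z"
    using Comp_Hom f g by blast
  have "image_sub C E M (g \<cdot> f) s \<sqsubseteq>\<^bsub>Sub C M Z\<^esub> u \<longleftrightarrow>
      image_sub C E M g (image_sub C E M f s) \<sqsubseteq>\<^bsub>Sub C M Z\<^esub> u"
    if u: "u \<in> carrier (Sub C M Z)" for u
  proof -
    obtain l where l: "l \<in> M" "Cod C l = Z" "u = sub_class Z l"
      using u Sub_cases by blast
    obtain m n e where m: "m \<in> M" "Cod C m = X" "s = sub_class X m"
      and n: "n \<in> M" "Cod C n = Y" and e: "e \<in> E" "Cod C e = Dom C n" "n \<cdot> e = f \<cdot> m"
      and im: "image_sub C E M f s = sub_class Y n"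
      by (rule image_sub_cases[OF s f])
    have nH: "n \<in> Hom C (Cod C e) Y"
      using M_Hom n e by metis
    \<comment> \<open>With \<open>f \<cdot> m\<close> replaced by its factorization,
      \<open>e\<close> stands rightmost and can be cancelled in the test against
      \<open>l\<close>.\<close>
    have "(g \<cdot> f) \<cdot> m = (g \<cdot> n) \<cdot> e"
      using Comp_assoc[OF E_Hom[OF e(1)] nH g] Comp_assoc[OF _ f g] M_Hom[OF m(1)] m e by simp
    moreover have "g \<cdot> n \<in> Hom C (Cod C e) Z"
      using Comp_Hom nH g by blast
    ultimately have "factors_through C ((g \<cdot> f) \<cdot> m) l = factors_through C (g \<cdot> n) l"
      using factors_through_E_comp_iff[OF e(1) _ l(1,2)] by simp
    then show ?thesis
      using image_sub_le_iff[OF gf m(1,2) l(1,2)] image_sub_le_iff[OF g n l(1,2)] m l im by simp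
  qed
  moreover have "image_sub C E M (g \<cdot> f) s \<in> carrier (Sub C M Z)"
    "image_sub C E M g (image_sub C E M f s) \<in> carrier (Sub C M Z)"
    using image_sub_carrier f g gf s by blast+
  ultimately show ?thesis
    using le_antisym le_refl by metis
qed

text \<open>The hypothesis is followed by the unit of the adjunction at \<open>t\<close> and
  transposed back.\<close>

lemma image_sub_mono:
  assumes f: "f \<in> Hom C X Y" and s: "s \<in> carrier (Sub C M X)" and t: "t \<in> carrier (Sub C M X)"
    and le: "s \<sqsubseteq>\<^bsub>Sub C M X\<^esub> t"
  shows "image_sub C E M f s \<sqsubseteq>\<^bsub>Sub C M Y\<^esub> image_sub C E M f t"
proof -
  interpret SX: partial_order "Sub C M X" by (rule partial_order_Sub)
  interpret SY: partial_order "Sub C M Y" by (rule partial_order_Sub)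
  have c: "image_sub C E M f t \<in> carrier (Sub C M Y)"
    using image_sub_carrier f t by blast
  then have "t \<sqsubseteq>\<^bsub>Sub C M X\<^esub> preimage_sub C f (image_sub C E M f t)"
    using image_le_iff_le_preimage[OF f t c] by simp
  then have "s \<sqsubseteq>\<^bsub>Sub C M X\<^esub> preimage_sub C f (image_sub C E M f t)"
    using SX.le_trans[OF le _ s t preimage_sub_carrier[OF f c]] by simp
  then show ?thesis
    using image_le_iff_le_preimage[OF f s c] by simp
qed

text \<open>The counit of the adjunction, by transposing reflexivity.\<close>

lemma image_preimage_le:
  assumes f: "f \<in> Hom C X Y" and t: "t \<in> carrier (Sub C M Y)"
  shows "image_sub C E M f (preimage_sub C f t) \<sqsubseteq>\<^bsub>Sub C M Y\<^esub> t"
proof -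
  interpret SX: partial_order "Sub C M X" by (rule partial_order_Sub)
  have c: "preimage_sub C f t \<in> carrier (Sub C M X)"
    using preimage_sub_carrier f t by blast
  show ?thesis
    using image_le_iff_le_preimage[OF f c t] SX.le_refl[OF c] by simp
qed

lemma preimage_sub_mono:
  assumes f: "f \<in> Hom C X Y" and s: "s \<in> carrier (Sub C M Y)" and t: "t \<in> carrier (Sub C M Y)"
    and le: "s \<sqsubseteq>\<^bsub>Sub C M Y\<^esub> t"
  shows "preimage_sub C f s \<sqsubseteq>\<^bsub>Sub C M X\<^esub> preimage_sub C f t"
proof -
  interpret SY: partial_order "Sub C M Y" by (rule partial_order_Sub)
  have c: "preimage_sub C f s \<in> carrier (Sub C M X)"
    using preimage_sub_carrier f s by blast
  have "image_sub C E M f (preimage_sub C f s) \<sqsubseteq>\<^bsub>Sub C M Y\<^esub> t"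
    using SY.le_trans[OF image_preimage_le[OF f s] le image_sub_carrier[OF f c] s t] .
  then show ?thesis
    using image_le_iff_le_preimage[OF f c t] by simp
qed

section \<open>Order-preserving maps and generated quasi-uniformities\<close>

lemma op_mapsD:
  assumes "U \<in> op_maps (Sub C M X)"
  shows "m \<in> carrier (Sub C M X) \<Longrightarrow> U m \<in> carrier (Sub C M X)"
    and "\<lbrakk>m \<in> carrier (Sub C M X); n \<in> carrier (Sub C M X); m \<sqsubseteq>\<^bsub>Sub C M X\<^esub> n\<rbrakk>
      \<Longrightarrow> U m \<sqsubseteq>\<^bsub>Sub C M X\<^esub> U n"
  using assms by (auto simp: op_maps_def isotone_def)

text \<open>The predicate \<open>isotone\<close> also demands that both orders be weak partial
  orders, which is discharged here once and for all.\<close>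

lemma op_mapsI:
  assumes "U \<in> extensional (carrier (Sub C M X))"
    and "\<And>m. m \<in> carrier (Sub C M X) \<Longrightarrow> U m \<in> carrier (Sub C M X)"
    and "\<And>m n. \<lbrakk>m \<in> carrier (Sub C M X); n \<in> carrier (Sub C M X); m \<sqsubseteq>\<^bsub>Sub C M X\<^esub> n\<rbrakk>
      \<Longrightarrow> U m \<sqsubseteq>\<^bsub>Sub C M X\<^esub> U n"
  shows "U \<in> op_maps (Sub C M X)"
proof -
  interpret partial_order "Sub C M X" by (rule partial_order_Sub)
  show ?thesis
    using assms weak_partial_order_axioms by (simp add: op_maps_def PiE_def isotone_def)
qed

lemma map_meet_op_maps:
  assumes X: "X \<in> Ob C" and U: "U \<in> op_maps (Sub C M X)" and V: "V \<in> op_maps (Sub C M X)"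
  shows "map_meet (Sub C M X) U V \<in> op_maps (Sub C M X)"
proof -
  interpret complete_lattice "Sub C M X" by (rule complete_lattice_Sub[OF X])
  show ?thesis
  proof (rule op_mapsI)
    fix m n
    assume m: "m \<in> carrier (Sub C M X)" and n: "n \<in> carrier (Sub C M X)"
      and le: "m \<sqsubseteq>\<^bsub>Sub C M X\<^esub> n"
    have c: "U m \<in> carrier (Sub C M X)" "V m \<in> carrier (Sub C M X)"
      "U n \<in> carrier (Sub C M X)" "V n \<in> carrier (Sub C M X)"
      using op_mapsD(1)[OF U] op_mapsD(1)[OF V] m n by simp_all
    have "U m \<sqinter>\<^bsub>Sub C M X\<^esub> V m \<sqsubseteq>\<^bsub>Sub C M X\<^esub> U n"
      using le_trans[OF meet_left[OF c(1,2)] op_mapsD(2)[OF U m n le]] c by simp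
    moreover have "U m \<sqinter>\<^bsub>Sub C M X\<^esub> V m \<sqsubseteq>\<^bsub>Sub C M X\<^esub> V n"
      using le_trans[OF meet_right[OF c(1,2)] op_mapsD(2)[OF V m n le]] c by simp
    ultimately show "map_meet (Sub C M X) U V m \<sqsubseteq>\<^bsub>Sub C M X\<^esub> map_meet (Sub C M X) U V n"
      using m n c by (simp add: map_meet_def meet_le)
  qed (use op_mapsD(1)[OF U] op_mapsD(1)[OF V] in \<open>auto simp: map_meet_def\<close>)
qed

lemma generated_qu_base:
  assumes U: "U \<in> B X" "U \<in> op_maps (Sub C M X)"
  shows "U \<in> generated_qu C M B X"
proof -
  interpret partial_order "Sub C M X" by (rule partial_order_Sub)
  have "map_le (Sub C M X) U U"
    using op_mapsD(1)[OF U(2)] by (simp add: map_le_def)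
  then show ?thesis
    using U by (auto simp: generated_qu_def)
qed

text \<open>Each axiom is inherited from a base member below the given map. The witnesses for (U2)
  and (U5) are base members themselves; for (U4) the meet of two base members lies below the meet of
  the given maps.\<close>

lemma quasi_uniformity_generated_qu:
  assumes base: "qu_base C E M C B"
  shows "quasi_uniformity C E M C (generated_qu C M B)"
proof -
  let ?Q = "generated_qu C M B"
  have Bop: "B X \<subseteq> op_maps (Sub C M X)" if "X \<in> Ob C" for X
    using base that unfolding qu_base_def by blast
  have "m \<sqsubseteq>\<^bsub>Sub C M X\<^esub> V m"
    if X: "X \<in> Ob C" and V: "V \<in> ?Q X" and m: "m \<in> carrier (Sub C M X)" for X V m
  proof -
    interpret partial_order "Sub C M X" by (rule partial_order_Sub)
    obtain U where U: "U \<in> B X" "map_le (Sub C M X) U V" and Vop: "V \<in> op_maps (Sub C M X)"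
      using V by (auto simp: generated_qu_def)
    have "m \<sqsubseteq>\<^bsub>Sub C M X\<^esub> U m"
      using base U(1) X m unfolding qu_base_def by blast
    moreover have "U m \<sqsubseteq>\<^bsub>Sub C M X\<^esub> V m"
      using U(2) m unfolding map_le_def by blast
    moreover have "U m \<in> carrier (Sub C M X)" "V m \<in> carrier (Sub C M X)"
      using op_mapsD(1)[OF subsetD[OF Bop[OF X] U(1)] m] op_mapsD(1)[OF Vop m] by simp_all
    ultimately show ?thesis
      using le_trans m by blast
  qed
  moreover have "\<exists>V'\<in>?Q X. map_le (Sub C M X) (compose (carrier (Sub C M X)) V' V') V"
    if X: "X \<in> Ob C" and V: "V \<in> ?Q X" for X V
  proof -
    interpret partial_order "Sub C M X" by (rule partial_order_Sub)
    obtain U where U: "U \<in> B X" "map_le (Sub C M X) U V" and Vop: "V \<in> op_maps (Sub C M X)"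
      using V by (auto simp: generated_qu_def)
    obtain W where W: "W \<in> B X" "map_le (Sub C M X) (compose (carrier (Sub C M X)) W W) U"
      using base X U(1) unfolding qu_base_def by blast
    have Wop: "W \<in> op_maps (Sub C M X)" and Uop: "U \<in> op_maps (Sub C M X)"
      using Bop[OF X] W(1) U(1) by blast+
    have "W (W m) \<sqsubseteq>\<^bsub>Sub C M X\<^esub> V m" if m: "m \<in> carrier (Sub C M X)" for m
    proof -
      have "W (W m) \<sqsubseteq>\<^bsub>Sub C M X\<^esub> U m" "U m \<sqsubseteq>\<^bsub>Sub C M X\<^esub> V m"
        using U(2) W(2) m by (auto simp: map_le_def compose_def)
      then show ?thesis
        using le_trans op_mapsD(1)[OF Wop op_mapsD(1)[OF Wop m]] op_mapsD(1)[OF Uop m]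
          op_mapsD(1)[OF Vop m] by blast
    qed
    then have "map_le (Sub C M X) (compose (carrier (Sub C M X)) W W) V"
      by (simp add: map_le_def compose_def)
    moreover have "W \<in> ?Q X"
      using generated_qu_base W(1) Wop by blast
    ultimately show ?thesis by blast
  qed
  moreover have "map_meet (Sub C M X) V V' \<in> ?Q X"
    if X: "X \<in> Ob C" and V: "V \<in> ?Q X" and V': "V' \<in> ?Q X" for X V V'
  proof -
    interpret complete_lattice "Sub C M X" by (rule complete_lattice_Sub[OF X])
    obtain U where U: "U \<in> B X" "map_le (Sub C M X) U V" and Vop: "V \<in> op_maps (Sub C M X)"
      using V by (auto simp: generated_qu_def)
    obtain U' where U': "U' \<in> B X" "map_le (Sub C M X) U' V'"
      and V'op: "V' \<in> op_maps (Sub C M X)"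
      using V' by (auto simp: generated_qu_def)
    have "U m \<sqinter>\<^bsub>Sub C M X\<^esub> U' m \<sqsubseteq>\<^bsub>Sub C M X\<^esub> V m \<sqinter>\<^bsub>Sub C M X\<^esub> V' m"
      if m: "m \<in> carrier (Sub C M X)" for m
    proof -
      have c: "U m \<in> carrier (Sub C M X)" "U' m \<in> carrier (Sub C M X)"
        "V m \<in> carrier (Sub C M X)" "V' m \<in> carrier (Sub C M X)"
        using op_mapsD(1)[OF subsetD[OF Bop[OF X] U(1)] m] op_mapsD(1)[OF Vop m]
          op_mapsD(1)[OF subsetD[OF Bop[OF X] U'(1)] m] op_mapsD(1)[OF V'op m] by simp_all
      have "U m \<sqsubseteq>\<^bsub>Sub C M X\<^esub> V m" "U' m \<sqsubseteq>\<^bsub>Sub C M X\<^esub> V' m"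
        using U(2) U'(2) m by (auto simp: map_le_def)
      then show ?thesis
        using le_trans[OF meet_left[OF c(1,2)]] le_trans[OF meet_right[OF c(1,2)]] c
        by (simp add: meet_le)
    qed
    then have "map_le (Sub C M X) (map_meet (Sub C M X) U U') (map_meet (Sub C M X) V V')"
      by (simp add: map_le_def map_meet_def)
    moreover have "map_meet (Sub C M X) U U' \<in> B X"
      using base X U(1) U'(1) unfolding qu_base_def by blast
    ultimately show ?thesis
      using map_meet_op_maps[OF X Vop V'op] by (auto simp: generated_qu_def)
  qed
  moreover have "\<exists>V'\<in>?Q X. \<forall>m\<in>carrier (Sub C M X).
      image_sub C E M f (V' m) \<sqsubseteq>\<^bsub>Sub C M Y\<^esub> V (image_sub C E M f m)"
    if f: "f \<in> Hom C X Y" and V: "V \<in> ?Q Y" for X Y f V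
  proof -
    interpret SX: partial_order "Sub C M X" by (rule partial_order_Sub)
    interpret SY: partial_order "Sub C M Y" by (rule partial_order_Sub)
    obtain U where U: "U \<in> B Y" "map_le (Sub C M Y) U V" and Vop: "V \<in> op_maps (Sub C M Y)"
      using V by (auto simp: generated_qu_def)
    obtain W where W: "W \<in> B X" "\<forall>m\<in>carrier (Sub C M X).
        image_sub C E M f (W m) \<sqsubseteq>\<^bsub>Sub C M Y\<^esub> U (image_sub C E M f m)"
      using base f U(1) unfolding qu_base_def by blast
    have Wop: "W \<in> op_maps (Sub C M X)" and Uop: "U \<in> op_maps (Sub C M Y)"
      using Bop W(1) U(1) HomD[OF f] by blast+
    have "image_sub C E M f (W m) \<sqsubseteq>\<^bsub>Sub C M Y\<^esub> V (image_sub C E M f m)"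
      if m: "m \<in> carrier (Sub C M X)" for m
    proof -
      have c: "image_sub C E M f m \<in> carrier (Sub C M Y)"
        "image_sub C E M f (W m) \<in> carrier (Sub C M Y)"
        using image_sub_carrier f m op_mapsD(1)[OF Wop] by blast+
      have "U (image_sub C E M f m) \<sqsubseteq>\<^bsub>Sub C M Y\<^esub> V (image_sub C E M f m)"
        using U(2) c by (auto simp: map_le_def)
      then show ?thesis
        using SY.le_trans W(2) m c(2) op_mapsD(1)[OF Uop c(1)] op_mapsD(1)[OF Vop c(1)] by blast
    qed
    moreover have "W \<in> ?Q X"
      using generated_qu_base W(1) Wop by blast
    ultimately show ?thesis by blast
  qed
  moreover have "V' \<in> ?Q X"
    if X: "X \<in> Ob C" and V: "V \<in> ?Q X" and V': "V' \<in> op_maps (Sub C M X)"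
      and le: "map_le (Sub C M X) V V'" for X V V'
  proof -
    interpret partial_order "Sub C M X" by (rule partial_order_Sub)
    obtain U where U: "U \<in> B X" "map_le (Sub C M X) U V" and Vop: "V \<in> op_maps (Sub C M X)"
      using V by (auto simp: generated_qu_def)
    have "U m \<sqsubseteq>\<^bsub>Sub C M X\<^esub> V' m" if m: "m \<in> carrier (Sub C M X)" for m
    proof -
      have "U m \<sqsubseteq>\<^bsub>Sub C M X\<^esub> V m" "V m \<sqsubseteq>\<^bsub>Sub C M X\<^esub> V' m"
        using U(2) le m by (auto simp: map_le_def)
      then show ?thesis
        using le_trans op_mapsD(1)[OF subsetD[OF Bop[OF X] U(1)] m] op_mapsD(1)[OF Vop m]
          op_mapsD(1)[OF V' m] by blast
    qed
    then show ?thesis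
      using U(1) V' by (auto simp: generated_qu_def map_le_def)
  qed
  moreover have "?Q X \<subseteq> op_maps (Sub C M X)" for X
    by (auto simp: generated_qu_def)
  ultimately show ?thesis
    unfolding quasi_uniformity_def qu_base_def by meson
qed

section \<open>Maps pulled back along a single morphism\<close>

definition pull_map :: "'o \<Rightarrow> 'a \<Rightarrow> ('a set \<Rightarrow> 'a set) \<Rightarrow> 'a set \<Rightarrow> 'a set" where
  "pull_map X f U = (\<lambda>m\<in>carrier (Sub C M X). preimage_sub C f (U (image_sub C E M f m)))"

context
  fixes f X Y
  assumes f: "f \<in> Hom C X Y"
begin

lemma pull_map_op_maps:
  assumes U: "U \<in> op_maps (Sub C M Y)"
  shows "pull_map X f U \<in> op_maps (Sub C M X)"
proof (rule op_mapsI)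
  fix m n
  assume "m \<in> carrier (Sub C M X)" "n \<in> carrier (Sub C M X)" "m \<sqsubseteq>\<^bsub>Sub C M X\<^esub> n"
  then show "pull_map X f U m \<sqsubseteq>\<^bsub>Sub C M X\<^esub> pull_map X f U n"
    unfolding pull_map_def
    using preimage_sub_mono[OF f] image_sub_mono[OF f] op_mapsD[OF U] image_sub_carrier[OF f]
    by simp
qed (use op_mapsD(1)[OF U] image_sub_carrier[OF f] preimage_sub_carrier[OF f] in
  \<open>auto simp: pull_map_def\<close>)

text \<open>The adjunction moves an inequality below a pulled back map to \<open>Sub C M Y\<close>,
  where the properties of \<open>U\<close> are available.\<close>

lemma le_pull_map_iff:
  assumes U: "U \<in> op_maps (Sub C M Y)" and m: "m \<in> carrier (Sub C M X)"
    and s: "s \<in> carrier (Sub C M X)"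
  shows "s \<sqsubseteq>\<^bsub>Sub C M X\<^esub> pull_map X f U m \<longleftrightarrow>
    image_sub C E M f s \<sqsubseteq>\<^bsub>Sub C M Y\<^esub> U (image_sub C E M f m)"
  using image_le_iff_le_preimage[OF f s op_mapsD(1)[OF U image_sub_carrier[OF f m]]] m
  by (simp add: pull_map_def)

lemma image_pull_map_le:
  assumes U: "U \<in> op_maps (Sub C M Y)" and m: "m \<in> carrier (Sub C M X)"
  shows "image_sub C E M f (pull_map X f U m) \<sqsubseteq>\<^bsub>Sub C M Y\<^esub> U (image_sub C E M f m)"
  using image_preimage_le[OF f op_mapsD(1)[OF U image_sub_carrier[OF f m]]] m
  by (simp add: pull_map_def)

text \<open>In the composite, an image after an inverse image stands between the two copies of
  \<open>W\<close>. The counit absorbs it, leaving \<open>W\<close> applied twice to the image of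
  \<open>m\<close>, which is below \<open>U\<close>.\<close>

lemma pull_map_compose_le:
  assumes U: "U \<in> op_maps (Sub C M Y)" and W: "W \<in> op_maps (Sub C M Y)"
    and le: "map_le (Sub C M Y) (compose (carrier (Sub C M Y)) W W) U"
  shows "map_le (Sub C M X)
    (compose (carrier (Sub C M X)) (pull_map X f W) (pull_map X f W)) (pull_map X f U)"
proof -
  interpret SY: partial_order "Sub C M Y" by (rule partial_order_Sub)
  have "pull_map X f W (pull_map X f W m) \<sqsubseteq>\<^bsub>Sub C M X\<^esub> pull_map X f U m"
    if m: "m \<in> carrier (Sub C M X)" for m
  proof -
    let ?m = "image_sub C E M f m" and ?p = "pull_map X f W m"
    let ?q = "pull_map X f W ?p"
    have p: "?p \<in> carrier (Sub C M X)" and q: "?q \<in> carrier (Sub C M X)"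
      using op_mapsD(1)[OF pull_map_op_maps[OF W]] m by simp_all
    have im: "?m \<in> carrier (Sub C M Y)" "image_sub C E M f ?p \<in> carrier (Sub C M Y)"
        "image_sub C E M f ?q \<in> carrier (Sub C M Y)"
      using image_sub_carrier[OF f] m p q by blast+
    note c = op_mapsD(1)[OF W im(1)] op_mapsD(1)[OF W im(2)] op_mapsD(1)[OF U im(1)]
      op_mapsD(1)[OF W op_mapsD(1)[OF W im(1)]]
    have "W (image_sub C E M f ?p) \<sqsubseteq>\<^bsub>Sub C M Y\<^esub> W (W ?m)"
      using op_mapsD(2)[OF W im(2) c(1) image_pull_map_le[OF W m]] .
    moreover have "W (W ?m) \<sqsubseteq>\<^bsub>Sub C M Y\<^esub> U ?m"
      using le im by (simp add: map_le_def compose_def)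
    ultimately have "W (image_sub C E M f ?p) \<sqsubseteq>\<^bsub>Sub C M Y\<^esub> U ?m"
      using SY.le_trans c by blast
    then have "image_sub C E M f ?q \<sqsubseteq>\<^bsub>Sub C M Y\<^esub> U ?m"
      using SY.le_trans[OF image_pull_map_le[OF W p]] im c by blast
    then show ?thesis
      using le_pull_map_iff[OF U m q] by simp
  qed
  then show ?thesis
    by (simp add: map_le_def compose_def)
qed

text \<open>Inverse images are right adjoints and so preserve meets; both sides are compared through
  their lower bounds. Equality is required because a base has to contain the meet of its members and
  not merely a map below it.\<close>

lemma map_meet_pull_map:
  assumes U: "U \<in> op_maps (Sub C M Y)" and V: "V \<in> op_maps (Sub C M Y)"
  shows "map_meet (Sub C M X) (pull_map X f U) (pull_map X f V) =
    pull_map X f (map_meet (Sub C M Y) U V)"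
proof (rule extensionalityI)
  interpret SX: complete_lattice "Sub C M X"
    using complete_lattice_Sub HomD[OF f] by blast
  interpret SY: complete_lattice "Sub C M Y"
    using complete_lattice_Sub HomD[OF f] by blast
  let ?W = "map_meet (Sub C M Y) U V"
  have W: "?W \<in> op_maps (Sub C M Y)"
    using map_meet_op_maps U V HomD[OF f] by blast
  fix m assume m: "m \<in> carrier (Sub C M X)"
  let ?m = "image_sub C E M f m" and ?a = "pull_map X f U m" and ?b = "pull_map X f V m"
  have im: "?m \<in> carrier (Sub C M Y)"
    using image_sub_carrier[OF f m] .
  have c: "?a \<in> carrier (Sub C M X)" "?b \<in> carrier (Sub C M X)"
    "pull_map X f ?W m \<in> carrier (Sub C M X)"
    using op_mapsD(1)[OF pull_map_op_maps _] U V W m by simp_all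
  have d: "U ?m \<in> carrier (Sub C M Y)" "V ?m \<in> carrier (Sub C M Y)"
    using op_mapsD(1)[OF U im] op_mapsD(1)[OF V im] by simp_all
  have "s \<sqsubseteq>\<^bsub>Sub C M X\<^esub> pull_map X f ?W m \<longleftrightarrow> s \<sqsubseteq>\<^bsub>Sub C M X\<^esub> ?a \<and> s \<sqsubseteq>\<^bsub>Sub C M X\<^esub> ?b"
    if s: "s \<in> carrier (Sub C M X)" for s
  proof -
    have js: "image_sub C E M f s \<in> carrier (Sub C M Y)"
      using image_sub_carrier[OF f s] .
    have "t \<sqsubseteq>\<^bsub>Sub C M Y\<^esub> U ?m \<sqinter>\<^bsub>Sub C M Y\<^esub> V ?m \<longleftrightarrow>
        t \<sqsubseteq>\<^bsub>Sub C M Y\<^esub> U ?m \<and> t \<sqsubseteq>\<^bsub>Sub C M Y\<^esub> V ?m"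
      if "t \<in> carrier (Sub C M Y)" for t
      using SY.le_trans[OF _ SY.meet_left[OF d]] SY.le_trans[OF _ SY.meet_right[OF d]]
        SY.meet_le d that by (metis SY.meet_closed)
    then show ?thesis
      using le_pull_map_iff[OF W m s] le_pull_map_iff[OF U m s] le_pull_map_iff[OF V m s] im js
      by (simp add: map_meet_def)
  qed
  then have "?a \<sqinter>\<^bsub>Sub C M X\<^esub> ?b = pull_map X f ?W m"
    using c SX.le_antisym SX.meet_le SX.meet_left SX.meet_right SX.meet_closed SX.le_refl by metis
  then show "map_meet (Sub C M X) (pull_map X f U) (pull_map X f V) m = pull_map X f ?W m"
    using m by (simp add: map_meet_def)
qed (auto simp: map_meet_def pull_map_def)

end

end

section \<open>Pulling a base back along the reflection\<close>

locale reflective_M_complete = M_complete_category C E M + reflective_subcategory C A Fo Fa \<eta>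
  for C :: "('o, 'a, 'z) category_scheme" and A :: "('o, 'a, 'y) category_scheme"
    and E M :: "'a set" and Fo :: "'o \<Rightarrow> 'o" and Fa :: "'a \<Rightarrow> 'a" and \<eta> :: "'o \<Rightarrow> 'a"
begin

definition pull_base :: "('o \<Rightarrow> ('a set \<Rightarrow> 'a set) set) \<Rightarrow> 'o \<Rightarrow> ('a set \<Rightarrow> 'a set) set" where
  "pull_base B X = pull_map X (\<eta> X) ` B (Fo X)"

context
  fixes B
  assumes base: "qu_base C E M A B"
begin

lemma base_op_maps: "\<lbrakk>X \<in> Ob C; U \<in> B (Fo X)\<rbrakk> \<Longrightarrow> U \<in> op_maps (Sub C M (Fo X))"
  using base Fo_Ob unfolding qu_base_def by blast

text \<open>Write \<open>p\<close> for the pulled back \<open>W\<close> at \<open>m\<close>. By the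
  adjunction for \<open>\<eta> Y\<close> it suffices to bound the image of \<open>p\<close> along
  \<open>\<eta> Y \<cdot> f\<close>, which by naturality is its image along
  \<open>Fa f \<cdot> \<eta> X\<close>. The counit bounds the latter by the image of
  \<open>W\<close> under \<open>Fa f\<close>, and (U5) for \<open>Fa f\<close> does the
  rest.\<close>

lemma pull_base_uniform:
  assumes f: "f \<in> Hom C X Y" and U: "U \<in> B (Fo Y)"
  shows "\<exists>V\<in>pull_base B X. \<forall>m\<in>carrier (Sub C M X).
    image_sub C E M f (V m) \<sqsubseteq>\<^bsub>Sub C M Y\<^esub> pull_map Y (\<eta> Y) U (image_sub C E M f m)"
proof -
  have X: "X \<in> Ob C" and Y: "Y \<in> Ob C"
    using HomD f by blast+
  note eX = eta_Hom[OF X] and eY = eta_Hom[OF Y]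
  have FfA: "Fa f \<in> Hom A (Fo X) (Fo Y)"
    using Fa_Hom f by blast
  \<comment> \<open>The reflected morphism is used in both roles: as an arrow of \<open>A\<close>
    for (U5), and as an arrow of \<open>C\<close> for images of subobjects.\<close>
  then have Ff: "Fa f \<in> Hom C (Fo X) (Fo Y)"
    using Ar_sub Dom_sub Cod_sub by (auto simp: Hom_def)
  interpret FY: partial_order "Sub C M (Fo Y)" by (rule partial_order_Sub)
  obtain W where W: "W \<in> B (Fo X)" "\<forall>m\<in>carrier (Sub C M (Fo X)).
      image_sub C E M (Fa f) (W m) \<sqsubseteq>\<^bsub>Sub C M (Fo Y)\<^esub> U (image_sub C E M (Fa f) m)"
    using base FfA U unfolding qu_base_def by blast
  have Uop: "U \<in> op_maps (Sub C M (Fo Y))" and Wop: "W \<in> op_maps (Sub C M (Fo X))"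
    using base_op_maps X Y U W(1) by blast+
  have natural: "image_sub C E M (\<eta> Y) (image_sub C E M f s) =
      image_sub C E M (Fa f) (image_sub C E M (\<eta> X) s)" if "s \<in> carrier (Sub C M X)" for s
    using image_sub_comp[OF f eY that] image_sub_comp[OF eX Ff that] eta_natural[OF f] by simp
  have "image_sub C E M f (pull_map X (\<eta> X) W m) \<sqsubseteq>\<^bsub>Sub C M Y\<^esub>
      pull_map Y (\<eta> Y) U (image_sub C E M f m)"
    if m: "m \<in> carrier (Sub C M X)" for m
  proof -
    let ?p = "pull_map X (\<eta> X) W m" and ?m = "image_sub C E M (\<eta> X) m"
    have p: "?p \<in> carrier (Sub C M X)"
      using op_mapsD(1)[OF pull_map_op_maps[OF eX Wop] m] .
    have im: "?m \<in> carrier (Sub C M (Fo X))"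
      "image_sub C E M (\<eta> X) ?p \<in> carrier (Sub C M (Fo X))"
      using image_sub_carrier[OF eX] m p by blast+
    have Wm: "W ?m \<in> carrier (Sub C M (Fo X))"
      using op_mapsD(1)[OF Wop im(1)] .
    have "image_sub C E M (Fa f) (image_sub C E M (\<eta> X) ?p)
        \<sqsubseteq>\<^bsub>Sub C M (Fo Y)\<^esub> image_sub C E M (Fa f) (W ?m)"
      using image_sub_mono[OF Ff im(2) Wm image_pull_map_le[OF eX Wop m]] .
    moreover have "image_sub C E M (Fa f) (W ?m)
        \<sqsubseteq>\<^bsub>Sub C M (Fo Y)\<^esub> U (image_sub C E M (Fa f) ?m)"
      using W(2) im(1) by blast
    ultimately have "image_sub C E M (Fa f) (image_sub C E M (\<eta> X) ?p)
        \<sqsubseteq>\<^bsub>Sub C M (Fo Y)\<^esub> U (image_sub C E M (Fa f) ?m)"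
      using FY.le_trans image_sub_carrier[OF Ff im(2)] image_sub_carrier[OF Ff Wm]
        op_mapsD(1)[OF Uop image_sub_carrier[OF Ff im(1)]] by blast
    then show ?thesis
      using le_pull_map_iff[OF eY Uop image_sub_carrier[OF f m] image_sub_carrier[OF f p]]
        natural[OF m] natural[OF p] by simp
  qed
  then show ?thesis
    using W(1) unfolding pull_base_def by blast
qed

lemma qu_base_pull_base: "qu_base C E M C (pull_base B)"
  unfolding qu_base_def
proof (intro conjI ballI allI)
  fix X assume X: "X \<in> Ob C"
  note eX = eta_Hom[OF X]
  show "pull_base B X \<subseteq> op_maps (Sub C M X)"
    using pull_map_op_maps[OF eX base_op_maps[OF X]] by (auto simp: pull_base_def)
  fix U' assume "U' \<in> pull_base B X"
  then obtain U where U: "U \<in> B (Fo X)" "U' = pull_map X (\<eta> X) U"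
    by (auto simp: pull_base_def)
  note Uop = base_op_maps[OF X U(1)]
  show "m \<sqsubseteq>\<^bsub>Sub C M X\<^esub> U' m" if m: "m \<in> carrier (Sub C M X)" for m
  proof -
    have "image_sub C E M (\<eta> X) m \<sqsubseteq>\<^bsub>Sub C M (Fo X)\<^esub> U (image_sub C E M (\<eta> X) m)"
      using base Fo_Ob[OF X] U(1) image_sub_carrier[OF eX m] unfolding qu_base_def by blast
    then show ?thesis
      using le_pull_map_iff[OF eX Uop m m] U(2) by simp
  qed
  obtain W where W: "W \<in> B (Fo X)"
    "map_le (Sub C M (Fo X)) (compose (carrier (Sub C M (Fo X))) W W) U"
    using base Fo_Ob[OF X] U(1) unfolding qu_base_def by blast
  have "map_le (Sub C M X) (compose (carrier (Sub C M X))
      (pull_map X (\<eta> X) W) (pull_map X (\<eta> X) W)) U'"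
    using pull_map_compose_le[OF eX Uop base_op_maps[OF X W(1)] W(2)] U(2) by simp
  then show "\<exists>V\<in>pull_base B X. map_le (Sub C M X) (compose (carrier (Sub C M X)) V V) U'"
    using W(1) unfolding pull_base_def by blast
  fix V' assume "V' \<in> pull_base B X"
  then obtain V where V: "V \<in> B (Fo X)" "V' = pull_map X (\<eta> X) V"
    by (auto simp: pull_base_def)
  have "map_meet (Sub C M (Fo X)) U V \<in> B (Fo X)"
    using base Fo_Ob[OF X] U(1) V(1) unfolding qu_base_def by blast
  then show "map_meet (Sub C M X) U' V' \<in> pull_base B X"
    using map_meet_pull_map[OF eX Uop base_op_maps[OF X V(1)]] U(2) V(2)
    unfolding pull_base_def by simp
next
  fix X Y f U' assume f: "f \<in> Hom C X Y" and "U' \<in> pull_base B Y"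
  then show "\<exists>V\<in>pull_base B X. \<forall>m\<in>carrier (Sub C M X).
      image_sub C E M f (V m) \<sqsubseteq>\<^bsub>Sub C M Y\<^esub> U' (image_sub C E M f m)"
    using pull_base_uniform[OF f] unfolding pull_base_def by blast
qed

section \<open>Continuity of the reflection and minimality\<close>

text \<open>For \<open>u\<close> above a base member \<open>U\<close>, the pulled back
  \<open>U\<close> is a witness by the counit.\<close>

lemma eta_qu_continuous:
  assumes X: "X \<in> Ob C"
  shows "qu_continuous C E M (\<eta> X) (generated_qu C M (pull_base B)) (generated_qu C M B)"
proof -
  note eX = eta_Hom[OF X]
  interpret FX: partial_order "Sub C M (Fo X)" by (rule partial_order_Sub)
  have "\<exists>v\<in>generated_qu C M (pull_base B) X. \<forall>m\<in>carrier (Sub C M X).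
      image_sub C E M (\<eta> X) (v m) \<sqsubseteq>\<^bsub>Sub C M (Fo X)\<^esub> u (image_sub C E M (\<eta> X) m)"
    if u: "u \<in> generated_qu C M B (Fo X)" for u
  proof -
    obtain U where U: "U \<in> B (Fo X)" "map_le (Sub C M (Fo X)) U u"
      and uop: "u \<in> op_maps (Sub C M (Fo X))"
      using u by (auto simp: generated_qu_def)
    note Uop = base_op_maps[OF X U(1)]
    note Pop = pull_map_op_maps[OF eX Uop]
    have "image_sub C E M (\<eta> X) (pull_map X (\<eta> X) U m)
        \<sqsubseteq>\<^bsub>Sub C M (Fo X)\<^esub> u (image_sub C E M (\<eta> X) m)"
      if m: "m \<in> carrier (Sub C M X)" for m
    proof -
      have im: "image_sub C E M (\<eta> X) m \<in> carrier (Sub C M (Fo X))"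
        using image_sub_carrier[OF eX m] .
      then have "U (image_sub C E M (\<eta> X) m) \<sqsubseteq>\<^bsub>Sub C M (Fo X)\<^esub> u (image_sub C E M (\<eta> X) m)"
        using U(2) by (simp add: map_le_def)
      then show ?thesis
        using FX.le_trans[OF image_pull_map_le[OF eX Uop m]] op_mapsD(1)[OF Uop im]
          op_mapsD(1)[OF uop im] image_sub_carrier[OF eX op_mapsD(1)[OF Pop m]] by blast
    qed
    moreover have "pull_map X (\<eta> X) U \<in> generated_qu C M (pull_base B) X"
      using U(1) Pop by (intro generated_qu_base) (auto simp: pull_base_def)
    ultimately show ?thesis by blast
  qed
  then show ?thesis
    using HomD[OF eX] by (simp add: qu_continuous_def)
qed

lemma generated_pull_base_coarsest:
  assumes V: "quasi_uniformity C E M C V"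
    and cont: "\<And>X. X \<in> Ob C \<Longrightarrow> qu_continuous C E M (\<eta> X) V (generated_qu C M B)"
  shows "coarser C M C (generated_qu C M (pull_base B)) V"
  unfolding coarser_def
proof (intro ballI)
  fix X U' assume X: "X \<in> Ob C" and U': "U' \<in> generated_qu C M (pull_base B) X"
  note eX = eta_Hom[OF X]
  interpret SX: partial_order "Sub C M X" by (rule partial_order_Sub)
  obtain U where U: "U \<in> B (Fo X)" "map_le (Sub C M X) (pull_map X (\<eta> X) U) U'"
    and U'op: "U' \<in> op_maps (Sub C M X)"
    using U' by (auto simp: generated_qu_def pull_base_def)
  note Uop = base_op_maps[OF X U(1)]
  note Pop = pull_map_op_maps[OF eX Uop]
  \<comment> \<open>Continuity is tested at the base member \<open>U\<close> itself, so that the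
    resulting \<open>v\<close> can be transposed to lie below the pulled back
    \<open>U\<close>.\<close>
  obtain v where v: "v \<in> V X" "\<forall>m\<in>carrier (Sub C M X).
      image_sub C E M (\<eta> X) (v m) \<sqsubseteq>\<^bsub>Sub C M (Fo X)\<^esub> U (image_sub C E M (\<eta> X) m)"
    using cont[OF X] generated_qu_base[where B = B and X = "Fo X", OF U(1) Uop]
    unfolding qu_continuous_def HomD(2,3)[OF eX] by blast
  have vop: "v \<in> op_maps (Sub C M X)"
    using V v(1) X unfolding quasi_uniformity_def qu_base_def by blast
  have "v m \<sqsubseteq>\<^bsub>Sub C M X\<^esub> U' m" if m: "m \<in> carrier (Sub C M X)" for m
  proof -
    have "v m \<sqsubseteq>\<^bsub>Sub C M X\<^esub> pull_map X (\<eta> X) U m"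
      using le_pull_map_iff[OF eX Uop m op_mapsD(1)[OF vop m]] v(2) m by blast
    moreover have "pull_map X (\<eta> X) U m \<sqsubseteq>\<^bsub>Sub C M X\<^esub> U' m"
      using U(2) m by (simp add: map_le_def)
    ultimately show ?thesis
      using SX.le_trans op_mapsD(1)[OF vop m] op_mapsD(1)[OF Pop m] op_mapsD(1)[OF U'op m]
      by blast
  qed
  then show "\<exists>v\<in>V X. map_le (Sub C M X) v U'"
    using v(1) unfolding map_le_def by blast
qed

end

section \<open>The base of the theorem and its transitivity\<close>

lemma refl_base_eq: "refl_base C E M Fo \<eta> S = pull_base (synt_base C M S)"
  by (simp add: fun_eq_iff refl_base_def pull_base_def pull_map_def image_image)

text \<open>
  Co-perfectness makes \<open>U m\<close> the least subobject related to \<open>m\<close>. Interpolating \<open>m\<close> and \<open>U m\<close>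
  by \<open>q\<close> forces \<open>U m \<sqsubseteq> q\<close> and \<open>U q \<sqsubseteq> U m\<close>, hence \<open>U (U m) \<sqsubseteq> U m\<close>.
\<close>

lemma pull_map_idem:
  assumes X: "X \<in> Ob C" and r: "topogenous_rel (Sub C M (Fo X)) r"
    and inf: "inf_preserving (Sub C M (Fo X)) r"
    and op: "rel_map (Sub C M (Fo X)) r \<in> op_maps (Sub C M (Fo X))"
    and infl: "\<And>m. m \<in> carrier (Sub C M (Fo X)) \<Longrightarrow>
      m \<sqsubseteq>\<^bsub>Sub C M (Fo X)\<^esub> rel_map (Sub C M (Fo X)) r m"
    and ip: "interpolates (refl_rel C E M Fo \<eta> X r)"
  defines "U \<equiv> pull_map X (\<eta> X) (rel_map (Sub C M (Fo X)) r)"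
  shows "compose (carrier (Sub C M X)) U U = U"
proof -
  note eX = eta_Hom[OF X]
  let ?R = "rel_map (Sub C M (Fo X)) r" and ?rA = "refl_rel C E M Fo \<eta> X r"
  interpret SX: partial_order "Sub C M X" by (rule partial_order_Sub)
  have "Fo X \<in> Ob C"
    using Fo_Ob[OF X] Ob_sub by blast
  then interpret FX: complete_lattice "Sub C M (Fo X)"
    by (rule complete_lattice_Sub)
  have rc: "{n. (m, n) \<in> r} \<subseteq> carrier (Sub C M (Fo X))" for m
    using r by (auto simp: topogenous_rel_def)
  have Uop: "U \<in> op_maps (Sub C M X)"
    unfolding U_def using pull_map_op_maps[OF eX op] .
  \<comment> \<open>The meet of all relatives of \<open>?m\<close> is again a relative of
    \<open>?m\<close> by \<open>inf\<close>, and it serves as the \<open>p\<close> in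
    \<open>refl_rel\<close>.\<close>
  have attained: "(m, U m) \<in> ?rA" if m: "m \<in> carrier (Sub C M X)" for m
  proof -
    let ?m = "image_sub C E M (\<eta> X) m"
    have im: "?m \<in> carrier (Sub C M (Fo X))"
      using image_sub_carrier[OF eX m] .
    then have "(?m, ?R ?m) \<in> r"
      using inf rc[of ?m] unfolding inf_preserving_def rel_map_def by simp
    moreover have "preimage_sub C (\<eta> X) (?R ?m) = U m"
      using m by (simp add: U_def pull_map_def)
    ultimately show ?thesis
      using m op_mapsD(1)[OF Uop m] op_mapsD(1)[OF op im] SX.le_refl
      unfolding refl_rel_def by auto
  qed
  \<comment> \<open>Any \<open>p\<close> witnessing the relation lies above the meet
    \<open>?R\<close> at the image of \<open>m\<close>, and inverse images are monotone.\<close>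
  have least: "U m \<sqsubseteq>\<^bsub>Sub C M X\<^esub> n" if mn: "(m, n) \<in> ?rA" for m n
  proof -
    obtain p where m: "m \<in> carrier (Sub C M X)" and n: "n \<in> carrier (Sub C M X)"
      and p: "p \<in> carrier (Sub C M (Fo X))" "(image_sub C E M (\<eta> X) m, p) \<in> r"
        "preimage_sub C (\<eta> X) p \<sqsubseteq>\<^bsub>Sub C M X\<^esub> n"
      using mn by (auto simp: refl_rel_def)
    have im: "image_sub C E M (\<eta> X) m \<in> carrier (Sub C M (Fo X))"
      using image_sub_carrier[OF eX m] .
    have "?R (image_sub C E M (\<eta> X) m) \<sqsubseteq>\<^bsub>Sub C M (Fo X)\<^esub> p"
      using FX.inf_lower[OF rc] p(2) im by (simp add: rel_map_def)
    then have "U m \<sqsubseteq>\<^bsub>Sub C M X\<^esub> preimage_sub C (\<eta> X) p"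
      using preimage_sub_mono[OF eX op_mapsD(1)[OF op im] p(1)] m by (simp add: U_def pull_map_def)
    then show ?thesis
      using SX.le_trans p(3) op_mapsD(1)[OF Uop m] preimage_sub_carrier[OF eX p(1)] n by blast
  qed
  have "U (U m) = U m" if m: "m \<in> carrier (Sub C M X)" for m
  proof -
    have Um: "U m \<in> carrier (Sub C M X)" and UUm: "U (U m) \<in> carrier (Sub C M X)"
      using op_mapsD(1)[OF Uop m] op_mapsD(1)[OF Uop op_mapsD(1)[OF Uop m]] .
    \<comment> \<open>Interpolation is available for the relation on \<open>X\<close> and not for
      \<open>r\<close>, so idempotence is proved for \<open>U\<close> directly instead of being
      inherited from \<open>?R\<close>.\<close>
    obtain q where q: "(m, q) \<in> ?rA" "(q, U m) \<in> ?rA"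
      using ip attained[OF m] unfolding interpolates_def by blast
    have qc: "q \<in> carrier (Sub C M X)"
      using q(1) by (auto simp: refl_rel_def)
    have "U (U m) \<sqsubseteq>\<^bsub>Sub C M X\<^esub> U q"
      using op_mapsD(2)[OF Uop Um qc least[OF q(1)]] .
    then have "U (U m) \<sqsubseteq>\<^bsub>Sub C M X\<^esub> U m"
      using SX.le_trans[OF _ least[OF q(2)] UUm op_mapsD(1)[OF Uop qc] Um] by blast
    moreover have "U m \<sqsubseteq>\<^bsub>Sub C M X\<^esub> U (U m)"
      using le_pull_map_iff[OF eX op Um Um] infl image_sub_carrier[OF eX Um]
      unfolding U_def by blast
    ultimately show ?thesis
      using SX.le_antisym UUm Um by blast
  qed
  moreover have "U \<in> extensional (carrier (Sub C M X))"
    by (simp add: U_def pull_map_def)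
  ultimately show ?thesis
    by (intro extensionalityI[of _ "carrier (Sub C M X)"]) (simp_all add: compose_def)
qed

lemma transitive_base_pull_base:
  assumes S: "syntopogenous C M A S" "co_perfect C M A S"
    and base: "qu_base C E M A (synt_base C M S)"
    and ip: "interpolative C (refl_synt C E M Fo \<eta> S)"
  shows "transitive_base C E M C (pull_base (synt_base C M S))"
  unfolding transitive_base_def
proof (intro conjI ballI)
  fix X U assume X: "X \<in> Ob C" and "U \<in> pull_base (synt_base C M S) X"
  then obtain r where r: "r \<in> S (Fo X)"
    and U: "U = pull_map X (\<eta> X) (rel_map (Sub C M (Fo X)) r)"
    by (auto simp: pull_base_def synt_base_def)
  have B: "rel_map (Sub C M (Fo X)) r \<in> synt_base C M S (Fo X)"
    using r by (simp add: synt_base_def)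
  note FX = Fo_Ob[OF X]
  show "compose (carrier (Sub C M X)) U U = U"
    unfolding U
  proof (rule pull_map_idem[OF X])
    show "topogenous_rel (Sub C M (Fo X)) r"
      using S(1) FX r unfolding syntopogenous_def by blast
    show "inf_preserving (Sub C M (Fo X)) r"
      using S(2) FX r unfolding co_perfect_def by blast
    show "rel_map (Sub C M (Fo X)) r \<in> op_maps (Sub C M (Fo X))"
      using base_op_maps[OF base X B] .
    show "interpolates (refl_rel C E M Fo \<eta> X r)"
      using ip X r unfolding interpolative_def refl_synt_def by blast
  qed (use base FX B in \<open>unfold qu_base_def, blast\<close>)
qed (rule qu_base_pull_base[OF base])

end

text \<open>The assumption on \<open>synt_base C M S\<close> expresses the convention that a
  co-perfect syntopogenous structure corresponds to a quasi-uniformity on \<open>A\<close>.\<close>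

theorem corollary3:
  fixes C :: "('o, 'a, 'z) category_scheme" and A :: "('o, 'a, 'y) category_scheme"
    and E M :: "'a set" and Fo :: "'o \<Rightarrow> 'o" and Fa :: "'a \<Rightarrow> 'a" and \<eta> :: "'o \<Rightarrow> 'a"
    and S :: "'o \<Rightarrow> 'a set rel set"
  assumes "M_complete_category C E M"
    and "reflective_subcategory C A Fo Fa \<eta>"
    and "syntopogenous C M A S"
    and "co_perfect C M A S"
    and "qu_base C E M A (synt_base C M S)"
  shows
    "let US = generated_qu C M (synt_base C M S);
         BA = refl_base C E M Fo \<eta> S;
         USA = generated_qu C M BA
     in qu_base C E M C BA \<and>
        quasi_uniformity C E M C USA \<and>
        (\<forall>X\<in>Ob C. qu_continuous C E M (\<eta> X) USA US) \<and>
        (\<forall>V. quasi_uniformity C E M C V \<and> (\<forall>X\<in>Ob C. qu_continuous C E M (\<eta> X) V US)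
          \<longrightarrow> coarser C M C USA V) \<and>
        (interpolative C (refl_synt C E M Fo \<eta> S) \<longrightarrow> transitive_base C E M C BA)"
proof -
  interpret reflective_M_complete C A E M Fo Fa \<eta>
    using assms(1,2) by (simp add: reflective_M_complete_def)
  note base = assms(5)
  note qu_base = qu_base_pull_base[OF base]
  show ?thesis
    unfolding Let_def refl_base_eq
    using qu_base quasi_uniformity_generated_qu[OF qu_base] eta_qu_continuous[OF base]
      generated_pull_base_coarsest[OF base] transitive_base_pull_base[OF assms(3-5)]
    by blast
qed

end
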